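(* Let $\mathcal N_{A\to B}$ be a quantum channel and let $\varepsilon,\delta\in(0,1)$. Then for any $R$ satisfying $$R\le\frac1\alpha\max_{\psi_{AA'}}D_{\mathrm H}^{\varepsilon}\big(\mathcal N_{A\to B}(\psi_{AA'})\,\big\|\,\mathcal N_{A\to B}(\psi_A)\otimes\psi_{A'}\big)-\frac4\alpha\log\frac2\delta,$$ where the maximum is over classical-quantum states $\psi_{AA'}$ in which the register $A'$ is classical, there exists an $(R,2\varepsilon+2\delta,\alpha)$-randomness assisted code for classical communication over $\mathcal N_{A\to B}$.
   Context: Logarithms are base 2; Hilbert spaces are finite dimensional. $D_{\mathrm H}^{\varepsilon}(\rho\|\sigma)=\sup_{0\preceq\Pi\preceq I,\ \mathrm{Tr}(\Pi\rho)\ge1-\varepsilon}\log\frac{1}{\mathrm{Tr}(\Pi\sigma)}$. Classical communication with a subset promise: Alice wants to communicate a classical message $M$, uniform in $[1:2^R]$, to Bob. Bob knows a subset $S\subset[1:2^R]$ of size $|S|=2^{\alpha R}$ ($\alpha>0$) containing the message; Alice does not know $S$, only $\alpha$. An $(R,\varepsilon,\alpha)$-randomness assisted code for classical communication over $\mathcal N_{A\to B}$ consists of shared randomness $\theta_{E_AE_B}$ between Alice ($E_A$) and Bob ($E_B$), an encoding operation $\mathcal E:ME_A\to A$ for Alice that does not depend on $S$, and a decoding operation $\mathcal D:BE_B\to M'$ for Bob, $M'\equiv M$ (which may depend on $S$), such that for every such $S$ and all $m\in S$, Bob decodes the message $m$ incorrectly with probability at most $\varepsilon$, i.e. $\Pr(M'\ne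 m\mid M=m)\le\varepsilon$. *)

theory Defs
  imports "Jordan_Normal_Form.Schur_Decomposition" "HOL-Library.Extended_Real"
begin

(* Operators on a d-dimensional Hilbert space are complex d x d matrices.  A bipartite system with
   local dimensions d and n has dimension d * n; the product basis vector (i, k) has index i * n + k,
   so that tensor products are strictly associative. *)

definition mtrace :: "complex mat \<Rightarrow> complex" where
  "mtrace A = (\<Sum>i<dim_row A. A $$ (i, i))"

(* The order on complex numbers makes 0 \<le> z say that z is real and nonnegative; hence Hermiticity
   is implied. *)
definition psd :: "nat \<Rightarrow> complex mat \<Rightarrow> bool" where
  "psd d A \<longleftrightarrow> A \<in> carrier_mat d d \<and> (\<forall>v \<in> carrier_vec d. 0 \<le> (A *\<^sub>v v) \<bullet>c v)"

definition density :: "nat \<Rightarrow> complex mat \<Rightarrow> bool" where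
  "density d \<rho> \<longleftrightarrow> psd d \<rho> \<and> mtrace \<rho> = 1"

definition tensor :: "complex mat \<Rightarrow> complex mat \<Rightarrow> complex mat" where
  "tensor A B = mat (dim_row A * dim_row B) (dim_col A * dim_col B)
     (\<lambda>(i, j). A $$ (i div dim_row B, j div dim_col B) * B $$ (i mod dim_row B, j mod dim_col B))"

definition trace_snd :: "nat \<Rightarrow> nat \<Rightarrow> complex mat \<Rightarrow> complex mat" where
  "trace_snd d n X = mat d d (\<lambda>(i, j). \<Sum>k<n. X $$ (i * n + k, j * n + k))"

definition trace_fst :: "nat \<Rightarrow> nat \<Rightarrow> complex mat \<Rightarrow> complex mat" where
  "trace_fst d n X = mat n n (\<lambda>(k, l). \<Sum>i<d. X $$ (i * n + k, i * n + l))"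

(* The map N tensor id_n, from dimension d * n to dimension d' * n: N is applied to each d x d block
   (<k| X |l>) of X, where k and l range over the basis of the second system. *)
definition on_first :: "nat \<Rightarrow> nat \<Rightarrow> nat \<Rightarrow> (complex mat \<Rightarrow> complex mat) \<Rightarrow> complex mat \<Rightarrow> complex mat" where
  "on_first d d' n N X = mat (d' * n) (d' * n)
     (\<lambda>(i, j). N (mat d d (\<lambda>(k, l). X $$ (k * n + i mod n, l * n + j mod n))) $$ (i div n, j div n))"

definition quantum_channel :: "nat \<Rightarrow> nat \<Rightarrow> (complex mat \<Rightarrow> complex mat) \<Rightarrow> bool" where
  "quantum_channel d d' N \<longleftrightarrow>
     (\<forall>X \<in> carrier_mat d d. N X \<in> carrier_mat d' d') \<and>
     (\<forall>X \<in> carrier_mat d d. \<forall>Y \<in> carrier_mat d d. N (X + Y) = N X + N Y) \<and>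
     (\<forall>c. \<forall>X \<in> carrier_mat d d. N (c \<cdot>\<^sub>m X) = c \<cdot>\<^sub>m N X) \<and>
     (\<forall>X \<in> carrier_mat d d. mtrace (N X) = mtrace X) \<and>
     (\<forall>n X. psd (d * n) X \<longrightarrow> psd (d' * n) (on_first d d' n N X))"

(* psi = sum_x p(x) rho_x (x) |x><x|, with A the first and the classical register A' the second
   system. *)
definition cq_state :: "nat \<Rightarrow> nat \<Rightarrow> complex mat \<Rightarrow> bool" where
  "cq_state d n \<psi> \<longleftrightarrow> (\<exists>(p :: nat \<Rightarrow> real) \<rho>.
     (\<forall>x<n. 0 \<le> p x) \<and> (\<Sum>x<n. p x) = 1 \<and> (\<forall>x<n. density d (\<rho> x)) \<and>
     \<psi> = mat (d * n) (d * n) (\<lambda>(i, j).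
           if i mod n = j mod n
           then complex_of_real (p (i mod n)) * \<rho> (i mod n) $$ (i div n, j div n) else 0))"

definition log_recip :: "real \<Rightarrow> ereal" where
  "log_recip t = (if t > 0 then ereal (log 2 (1 / t)) else \<infinity>)"

definition hyp_test_div :: "nat \<Rightarrow> real \<Rightarrow> complex mat \<Rightarrow> complex mat \<Rightarrow> ereal" where
  "hyp_test_div d \<epsilon> \<rho> \<sigma> =
     (SUP T \<in> {T. psd d T \<and> psd d (1\<^sub>m d - T) \<and> Re (mtrace (T * \<rho>)) \<ge> 1 - \<epsilon>}.
        log_recip (Re (mtrace (T * \<sigma>))))"

(* The dimension n of the classical register A' is an arbitrary finite one. *)
definition cq_hyp_test_info :: "nat \<Rightarrow> nat \<Rightarrow> (complex mat \<Rightarrow> complex mat) \<Rightarrow> real \<Rightarrow> ereal" where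
  "cq_hyp_test_info dA dB N \<epsilon> =
     Sup {hyp_test_div (dB * n) \<epsilon> (on_first dA dB n N \<psi>)
            (tensor (N (trace_snd dA n \<psi>)) (trace_fst dA n \<psi>)) | n \<psi>. cq_state dA n \<psi>}"

definition basis_state :: "nat \<Rightarrow> nat \<Rightarrow> complex mat" where
  "basis_state K m = mat K K (\<lambda>(i, j). if i = m \<and> j = m then 1 else 0)"

(* State of M' at the end of the protocol, for message m:
   E acts on M E_A, then N on A, then D on B E_B. *)
definition code_output ::
  "nat \<Rightarrow> nat \<Rightarrow> (complex mat \<Rightarrow> complex mat) \<Rightarrow> nat \<Rightarrow> nat \<Rightarrow> nat \<Rightarrow> complex mat \<Rightarrow>
   (complex mat \<Rightarrow> complex mat) \<Rightarrow> (complex mat \<Rightarrow> complex mat) \<Rightarrow> nat \<Rightarrow> complex mat" where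
  "code_output dA dB N K eA eB \<theta> E D m =
     D (on_first dA dB eB N (on_first (K * eA) dA eB E (tensor (basis_state K m) \<theta>)))"

(* Pr(M' \<noteq> m | M = m) *)
definition error_prob ::
  "nat \<Rightarrow> nat \<Rightarrow> (complex mat \<Rightarrow> complex mat) \<Rightarrow> nat \<Rightarrow> nat \<Rightarrow> nat \<Rightarrow> complex mat \<Rightarrow>
   (complex mat \<Rightarrow> complex mat) \<Rightarrow> (complex mat \<Rightarrow> complex mat) \<Rightarrow> nat \<Rightarrow> real" where
  "error_prob dA dB N K eA eB \<theta> E D m =
     (\<Sum>m' \<in> {..<K} - {m}. Re (code_output dA dB N K eA eB \<theta> E D m $$ (m', m')))"

(* Messages are numbered from 0.  Powers 2^R and 2^(alpha R) that are not integers are rounded down.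
   The shared randomness theta is a classical state of E_A E_B, i.e. a density operator that is
   diagonal in the product basis.  Only the decoder receives the subset S; its output register M'
   is classical, so its outputs are diagonal. *)
definition randomness_assisted_code ::
  "nat \<Rightarrow> nat \<Rightarrow> (complex mat \<Rightarrow> complex mat) \<Rightarrow> real \<Rightarrow> real \<Rightarrow> real \<Rightarrow> nat \<Rightarrow> nat \<Rightarrow> complex mat \<Rightarrow>
   (complex mat \<Rightarrow> complex mat) \<Rightarrow> (nat set \<Rightarrow> complex mat \<Rightarrow> complex mat) \<Rightarrow> bool" where
  "randomness_assisted_code dA dB N R \<epsilon> \<alpha> eA eB \<theta> E D \<longleftrightarrow>
     (let K = nat \<lfloor>2 powr R\<rfloor> in
       density (eA * eB) \<theta> \<and> diagonal_mat \<theta> \<and>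
       quantum_channel (K * eA) dA E \<and>
       (\<forall>S. S \<subseteq> {..<K} \<and> card S = nat \<lfloor>2 powr (\<alpha> * R)\<rfloor> \<longrightarrow>
          quantum_channel (dB * eB) K (D S) \<and>
          (\<forall>X \<in> carrier_mat (dB * eB) (dB * eB). diagonal_mat (D S X)) \<and>
          (\<forall>m \<in> S. error_prob dA dB N K eA eB \<theta> E (D S) m \<le> \<epsilon>)))"

end

(* Position-based coding with a pretty good measurement.  Take a test T and a cq state
   sum_x p(x) rho_x (x) |x><x| that nearly attain the hypothesis testing divergence; only the diagonal
   blocks T_x of T matter, because A' is classical.  The shared randomness is a codebook k: one symbol
   x_m(k), drawn from p, for every message m.  Alice sends rho at the symbol of her message.  Bob, who
   knows S, applies to B the pretty good measurement built from the tests T at the symbols x_m(k),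
   m in S.  The Hayashi-Nagaoka inequality bounds the error for every m in S by twice the miss
   probability of T plus 4 (|S| - 1) times its false alarm probability.  The margin 4 log(2 / delta)
   pays for the factor 4 and for the supremum possibly not being attained. *)

theory Submission
  imports Defs
begin

section \<open>Quadratic forms and adjoints\<close>

text \<open>The codebook index stays inside the shared randomness, so the error of the code is by
  construction an average over codebooks. This is what gives a bound for every S and every m in S at
  once: any two distinct codewords have the same product law, no single codebook is ever selected,
  and the encoder serves all messages without reference to S. The subset acts only in the decoder,
  where it cuts the number of competitors from 2^R to about 2^(\<alpha> R); hence the factor 1 /
  \<alpha> in the rate. The symbol of a competitor is independent of the transmitted state, so its
  test sees the product of the marginals, which is the second argument of the divergence. The
  obstacle is the measurement. Tests at different symbols need not commute and their sum may be
  singular, so it is normalised by a pseudo-inverse square root, and what is then missing from the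
  identity goes to one outcome. The analysis of this measurement is done with quadratic forms at a
  single vector; a rank-one decomposition of the state carries it over to traces. This is why
  spectral theory of positive matrices comes before any coding.\<close>

definition sesq :: "complex mat \<Rightarrow> complex vec \<Rightarrow> complex vec \<Rightarrow> complex" where
  "sesq A x y = (A *\<^sub>v x) \<bullet>c y"

lemma sesq_sum:
  assumes "A \<in> carrier_mat d d" "x \<in> carrier_vec d" "y \<in> carrier_vec d"
  shows "sesq A x y = (\<Sum>i<d. \<Sum>j<d. A $$ (i, j) * x $ j * cnj (y $ i))"
  using assms unfolding sesq_def
  by (auto simp: scalar_prod_def row_def atLeast0LessThan sum_distrib_right intro!: sum.cong)

lemma sesq_add_mat:
  assumes "A \<in> carrier_mat d d" "B \<in> carrier_mat d d" "x \<in> carrier_vec d" "y \<in> carrier_vec d"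
  shows "sesq (A + B) x y = sesq A x y + sesq B x y"
  using assms by (simp add: sesq_sum[of _ d] sum.distrib algebra_simps)

lemma sesq_minus_mat:
  assumes "A \<in> carrier_mat d d" "B \<in> carrier_mat d d" "x \<in> carrier_vec d" "y \<in> carrier_vec d"
  shows "sesq (A - B) x y = sesq A x y - sesq B x y"
  using assms minus_carrier_mat[OF assms(2), of A]
  by (simp add: sesq_sum[of _ d] sum_subtractf left_diff_distrib)

lemma sesq_minus_left:
  assumes "A \<in> carrier_mat d d" "x \<in> carrier_vec d" "x' \<in> carrier_vec d" "y \<in> carrier_vec d"
  shows "sesq A (x - x') y = sesq A x y - sesq A x' y"
  using assms by (simp add: sesq_sum[of _ d] sum_subtractf algebra_simps)

lemma sesq_minus_right:
  assumes "A \<in> carrier_mat d d" "x \<in> carrier_vec d" "y' \<in> carrier_vec d" "y \<in> carrier_vec d"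
  shows "sesq A x (y - y') = sesq A x y - sesq A x y'"
  using assms by (simp add: sesq_sum[of _ d] sum_subtractf algebra_simps)

lemma sesq_add_left:
  assumes "A \<in> carrier_mat d d" "x \<in> carrier_vec d" "x' \<in> carrier_vec d" "y \<in> carrier_vec d"
  shows "sesq A (x + x') y = sesq A x y + sesq A x' y"
  using assms by (simp add: sesq_sum[of _ d] sum.distrib algebra_simps)

lemma sesq_add_right:
  assumes "A \<in> carrier_mat d d" "x \<in> carrier_vec d" "y' \<in> carrier_vec d" "y \<in> carrier_vec d"
  shows "sesq A x (y + y') = sesq A x y + sesq A x y'"
  using assms by (simp add: sesq_sum[of _ d] sum.distrib algebra_simps)

lemma sesq_smult_left:
  assumes "A \<in> carrier_mat d d" "x \<in> carrier_vec d" "y \<in> carrier_vec d"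
  shows "sesq A (c \<cdot>\<^sub>v x) y = c * sesq A x y"
  using assms by (simp add: sesq_sum[of _ d] sum_distrib_left algebra_simps)

lemma sesq_smult_right:
  assumes "A \<in> carrier_mat d d" "x \<in> carrier_vec d" "y \<in> carrier_vec d"
  shows "sesq A x (c \<cdot>\<^sub>v y) = cnj c * sesq A x y"
  using assms by (simp add: sesq_sum[of _ d] sum_distrib_left algebra_simps)

lemma sesq_unit_vec:
  assumes "A \<in> carrier_mat d d" "i < d" "j < d"
  shows "sesq A (unit_vec d i) (unit_vec d j) = A $$ (j, i)"
proof -
  have "sesq A (unit_vec d i) (unit_vec d j) =
    (\<Sum>a<d. \<Sum>b<d. A $$ (a, b) * unit_vec d i $ b * cnj (unit_vec d j $ a))"
    using assms by (subst sesq_sum[of _ d]) auto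
  also have "\<dots> = (\<Sum>a<d. \<Sum>b<d. if b = i then (if a = j then A $$ (a, b) else 0) else 0)"
    using assms by (intro sum.cong refl) auto
  also have "\<dots> = A $$ (j, i)"
    using assms by simp
  finally show ?thesis .
qed

lemma psdD:
  assumes "psd d A"
  shows "A \<in> carrier_mat d d" "v \<in> carrier_vec d \<Longrightarrow> 0 \<le> sesq A v v"
  using assms unfolding psd_def sesq_def by auto

lemma psdI:
  assumes "A \<in> carrier_mat d d" "\<And>v. v \<in> carrier_vec d \<Longrightarrow> 0 \<le> sesq A v v"
  shows "psd d A"
  using assms unfolding psd_def sesq_def by auto

lemma mat_adjoint_dim[simp]:
  "dim_row (mat_adjoint A) = dim_col A" "dim_col (mat_adjoint A) = dim_row A"
  unfolding mat_adjoint_def by auto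

lemma mat_adjoint_carrier[simp]:
  "A \<in> carrier_mat n m \<Longrightarrow> mat_adjoint A \<in> carrier_mat m n"
  by auto

lemma mat_adjoint_index[simp]:
  "i < dim_col A \<Longrightarrow> j < dim_row A \<Longrightarrow> mat_adjoint A $$ (i, j) = conjugate (A $$ (j, i))"
  unfolding mat_adjoint_def by (simp add: mat_of_rows_def)

lemma mat_adjoint_mult:
  fixes A B :: "complex mat"
  assumes "A \<in> carrier_mat n m" "B \<in> carrier_mat m k"
  shows "mat_adjoint (A * B) = mat_adjoint B * mat_adjoint A"
  using assms
  by (intro eq_matI) (auto simp: scalar_prod_def mult.commute intro!: sum.cong)

lemma mat_adjoint_adjoint[simp]: "mat_adjoint (mat_adjoint A) = A"
  by (intro eq_matI) auto

lemma sesq_adjoint: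
  assumes "A \<in> carrier_mat d d" "x \<in> carrier_vec d" "y \<in> carrier_vec d"
  shows "sesq (mat_adjoint A) x y = cnj (sesq A y x)"
proof -
  have "sesq (mat_adjoint A) x y = (\<Sum>i<d. \<Sum>j<d. cnj (A $$ (j, i)) * x $ j * cnj (y $ i))"
    using assms by (simp add: sesq_sum[of _ d])
  also have "\<dots> = (\<Sum>j<d. \<Sum>i<d. cnj (A $$ (j, i)) * x $ j * cnj (y $ i))"
    by (rule sum.swap)
  also have "\<dots> = cnj (sesq A y x)"
    using assms by (simp add: sesq_sum[of _ d] algebra_simps)
  finally show ?thesis .
qed

lemma sesq_mult_right:
  assumes "A \<in> carrier_mat d d" "B \<in> carrier_mat d d" "x \<in> carrier_vec d"
  shows "sesq (A * B) x y = sesq A (B *\<^sub>v x) y"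
  using assms unfolding sesq_def by (simp add: assoc_mult_mat_vec)

lemma sesq_mult_left:
  assumes "A \<in> carrier_mat d d" "B \<in> carrier_mat d d" "x \<in> carrier_vec d" "y \<in> carrier_vec d"
  shows "sesq (A * B) x y = sesq B x (mat_adjoint A *\<^sub>v y)"
proof -
  have "sesq (A * B) x y = cnj (sesq (mat_adjoint (A * B)) y x)"
    using assms by (subst sesq_adjoint[of _ d]) auto
  also have "\<dots> = cnj (sesq (mat_adjoint B) (mat_adjoint A *\<^sub>v y) x)"
    using assms by (simp add: mat_adjoint_mult[of _ d d _ d] sesq_mult_right[of _ d])
  also have "\<dots> = sesq B x (mat_adjoint A *\<^sub>v y)"
    using assms mult_mat_vec_carrier[OF mat_adjoint_carrier[OF assms(1)] assms(4)]
    by (subst sesq_adjoint[of _ d]) auto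
  finally show ?thesis .
qed

lemma psd_congruence:
  assumes "psd d A" "W \<in> carrier_mat d d"
  shows "psd d (mat_adjoint W * A * W)"
proof (rule psdI)
  note A = psdD(1)[OF assms(1)]
  show "mat_adjoint W * A * W \<in> carrier_mat d d"
    using assms A by auto
  fix v :: "complex vec" assume v: "v \<in> carrier_vec d"
  have "sesq (mat_adjoint W * A * W) v v = sesq A (W *\<^sub>v v) (W *\<^sub>v v)"
    using assms A v by (subst sesq_mult_right[of _ d], auto, subst sesq_mult_left[of _ d], auto)
  then show "0 \<le> sesq (mat_adjoint W * A * W) v v"
    using psdD(2)[OF assms(1)] assms v by auto
qed

text \<open>Polarization: the form is real on every \<open>u i + c * u j\<close>. Taking c = 1 gives
  the imaginary part of the sum of the two mirrored entries, and taking c as the imaginary unit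
  gives the real part of their difference.\<close>

lemma psd_hermitian:
  assumes "psd d A"
  shows "mat_adjoint A = A"
proof (rule eq_matI)
  note A = psdD(1)[OF assms]
  show "dim_row (mat_adjoint A) = dim_row A" "dim_col (mat_adjoint A) = dim_col A"
    using A by auto
  fix i j assume "i < dim_row A" "j < dim_col A"
  then have i: "i < d" and j: "j < d" using A by auto
  define u where "u i = (unit_vec d i :: complex vec)" for i
  have u: "u i \<in> carrier_vec d" for i by (simp add: u_def)
  have ent: "sesq A (u k) (u l) = A $$ (l, k)" if "k < d" "l < d" for k l
    unfolding u_def using sesq_unit_vec[OF A that] .
  have expand: "sesq A (u i + c \<cdot>\<^sub>v u j) (u i + c \<cdot>\<^sub>v u j) =
      A $$ (i, i) + cnj c * A $$ (j, i) + c * A $$ (i, j) + c * cnj c * A $$ (j, j)" for c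
    using A u i j
    by (simp add: sesq_add_left[of _ d] sesq_add_right[of _ d] sesq_smult_left[of _ d]
        sesq_smult_right[of _ d] ent algebra_simps)
  have real: "Im (sesq A v v) = 0" if "v \<in> carrier_vec d" for v
    using psdD(2)[OF assms that] by (simp add: less_eq_complex_def)
  have diag: "Im (A $$ (k, k)) = 0" if "k < d" for k
    using real[OF u[of k]] ent[OF that that] by simp
  have "Im (sesq A (u i + 1 \<cdot>\<^sub>v u j) (u i + 1 \<cdot>\<^sub>v u j)) = 0"
    "Im (sesq A (u i + \<i> \<cdot>\<^sub>v u j) (u i + \<i> \<cdot>\<^sub>v u j)) = 0"
    using u by (auto intro!: real)
  then have "Im (A $$ (j, i)) + Im (A $$ (i, j)) = 0" "Re (A $$ (i, j)) - Re (A $$ (j, i)) = 0"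
    unfolding expand using diag[OF i] diag[OF j] by auto
  then have "cnj (A $$ (j, i)) = A $$ (i, j)"
    by (auto simp: complex_eq_iff)
  then show "mat_adjoint A $$ (i, j) = A $$ (i, j)"
    using A i j by simp
qed

section \<open>Spectral theorem for Hermitian matrices\<close>

text \<open>Prepares deflation in the spectral theorem: Gram-Schmidt on a basis that starts with
  \<open>v\<close>, each vector then divided by its norm \<open>q j\<close>. The scalar
  \<open>c\<close> absorbs the norm, so an eigenvector of any length may be supplied.\<close>

lemma unitary_completion:
  fixes v :: "complex vec"
  assumes v: "v \<in> carrier_vec n" and v0: "v \<noteq> 0\<^sub>v n"
  obtains W c where "W \<in> carrier_mat n n" "mat_adjoint W * W = 1\<^sub>m n" "col W 0 = c \<cdot>\<^sub>v v"
proof -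
  interpret cof_vec_space n "TYPE(complex)" .
  define b where "b = basis_completion v"
  define ws where "ws = gram_schmidt n b"
  from basis_completion[OF v v0, folded b_def]
  have dist_b: "distinct b" and indep: "\<not> lin_dep (set b)" and b: "set b \<subseteq> carrier_vec n"
    and hdb: "hd b = v" and len_b: "length b = n" by auto
  have "n \<noteq> 0" using v v0 by auto
  with hdb len_b obtain vs where bv: "b = v # vs" by (cases b, auto)
  from gram_schmidt_result[OF b dist_b indep refl, folded ws_def]
  have ws: "set ws \<subseteq> carrier_vec n" "corthogonal ws" "length ws = n"
    by (auto simp: len_b)
  have "hd ws = v" using gram_schmidt_hd[OF v, of vs, folded bv] unfolding ws_def .
  then have ws0: "ws ! 0 = v" using ws(3) \<open>n \<noteq> 0\<close> by (cases ws) auto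
  have wsc: "ws ! j \<in> carrier_vec n" if "j < n" for j
    using ws that by auto
  have ip: "(\<Sum>k<n. ws ! i $ k * cnj (ws ! j $ k)) = ws ! i \<bullet>c ws ! j" if "i < n" "j < n" for i j
    using wsc[OF that(1)] wsc[OF that(2)] by (simp add: scalar_prod_def atLeast0LessThan)
  define q where "q j = sqrt (Re (ws ! j \<bullet>c ws ! j))" for j
  have pos: "0 < ws ! j \<bullet>c ws ! j" if "j < n" for j
  proof -
    have "ws ! j \<bullet>c ws ! j \<noteq> 0"
      using corthogonalD[OF ws(2)] that ws(3) by auto
    moreover have "0 \<le> ws ! j \<bullet>c ws ! j" by (rule conjugate_square_ge_0_vec)
    ultimately show ?thesis by auto
  qed
  have q: "complex_of_real (q j) * complex_of_real (q j) = ws ! j \<bullet>c ws ! j" "q j \<noteq> 0" if "j < n" for j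
    using pos[OF that] unfolding q_def
    by (auto simp: less_complex_def complex_eq_iff simp flip: of_real_mult)
  define W where "W = mat n n (\<lambda>(i, j). ws ! j $ i / complex_of_real (q j))"
  have W: "W \<in> carrier_mat n n" unfolding W_def by auto
  moreover have "mat_adjoint W * W = 1\<^sub>m n"
  proof (rule eq_matI)
    fix i j assume "i < dim_row (1\<^sub>m n :: complex mat)" "j < dim_col (1\<^sub>m n :: complex mat)"
    then have i: "i < n" and j: "j < n" by auto
    have "(mat_adjoint W * W) $$ (i, j) = (\<Sum>k<n. cnj (W $$ (k, i)) * W $$ (k, j))"
      using W i j by (simp add: scalar_prod_def atLeast0LessThan)
    also have "\<dots> = (\<Sum>k<n. ws ! j $ k * cnj (ws ! i $ k)) / (complex_of_real (q j) * complex_of_real (q i))"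
      unfolding W_def using i j by (simp add: sum_divide_distrib mult.commute)
    also have "\<dots> = (if i = j then 1 else 0)"
      using ip[OF j i] corthogonalD[OF ws(2), of j i] ws(3) i j q[OF i] pos[OF i] by auto
    finally show "(mat_adjoint W * W) $$ (i, j) = 1\<^sub>m n $$ (i, j)"
      using i j by simp
  qed (use W in auto)
  moreover have "col W 0 = (1 / complex_of_real (q 0)) \<cdot>\<^sub>v v"
    using W \<open>n \<noteq> 0\<close> ws0 v by (intro eq_vecI) (auto simp: W_def)
  ultimately show thesis by (rule that)
qed

lemma mat_adjoint_four_block_mat:
  assumes "A \<in> carrier_mat a b" "B \<in> carrier_mat a d" "C \<in> carrier_mat c b" "D \<in> carrier_mat c d"
  shows "mat_adjoint (four_block_mat A B C D) =
    four_block_mat (mat_adjoint A) (mat_adjoint C) (mat_adjoint B) (mat_adjoint D)"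
  using assms by (intro eq_matI) auto

text \<open>Induction by deflation. A unitary \<open>W\<close> whose first column is an eigenvector
  makes the first column of \<open>B\<close> equal to \<open>e\<close> times a unit vector. As
  \<open>B\<close> is again Hermitian, its first row is cleared too and \<open>e\<close> is real,
  and the induction hypothesis applies to the lower block \<open>B3\<close>.\<close>

lemma hermitian_spectral:
  assumes "A \<in> carrier_mat n n" "mat_adjoint A = A"
  obtains U l where "U \<in> carrier_mat n n" "mat_adjoint U * U = 1\<^sub>m n" "U * mat_adjoint U = 1\<^sub>m n"
    "A = U * mat_diag n (\<lambda>i. complex_of_real (l i)) * mat_adjoint U"
proof -
  \<comment> \<open>The identity \<open>U * mat_adjoint U = 1\<^sub>m n\<close> stays out of the
    induction: for square matrices it follows from the other one, and is recovered at the
    end.\<close>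
  have "\<exists>U l. U \<in> carrier_mat n n \<and> mat_adjoint U * U = 1\<^sub>m n \<and>
    A = U * mat_diag n (\<lambda>i. complex_of_real (l i)) * mat_adjoint U"
    using assms
  proof (induction n arbitrary: A)
    case 0
    then show ?case by (intro exI[of _ "1\<^sub>m 0"] exI[of _ "\<lambda>_. 0"] conjI eq_matI) auto
  next
    case (Suc m)
    let ?n = "Suc m"
    note A = Suc.prems(1)
    obtain as where as: "char_poly A = (\<Prod>a\<leftarrow>as. [:- a, 1:])" "length as = ?n"
      using char_poly_factorized[OF A] by auto
    then obtain e es where "as = e # es" by (cases as) auto
    then have "poly (char_poly A) e = 0" unfolding as(1) by simp
    then have "eigenvalue A e" using eigenvalue_root_char_poly[OF A] by simp
    then obtain v where v: "v \<in> carrier_vec ?n" "v \<noteq> 0\<^sub>v ?n" and Av: "A *\<^sub>v v = e \<cdot>\<^sub>v v"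
      using A unfolding eigenvalue_def eigenvector_def by auto
    obtain W c where W: "W \<in> carrier_mat ?n ?n" and W1: "mat_adjoint W * W = 1\<^sub>m ?n"
      and colW: "col W 0 = c \<cdot>\<^sub>v v" by (rule unitary_completion[OF v])
    have W': "mat_adjoint W \<in> carrier_mat ?n ?n" using W by simp
    have W2: "W * mat_adjoint W = 1\<^sub>m ?n"
      by (rule mat_mult_left_right_inverse[OF W' W W1])
    define B where "B = mat_adjoint W * A * W"
    have B: "B \<in> carrier_mat ?n ?n" unfolding B_def using W W' A by auto
    have Bh: "mat_adjoint B = B"
      unfolding B_def using W W' A Suc.prems(2)
      by (simp add: mat_adjoint_mult[of _ ?n ?n _ ?n] assoc_mult_mat[of _ ?n ?n _ ?n _ ?n] mult_carrier_mat[of _ ?n ?n _ ?n])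
    have Bh': "cnj (B $$ (j, i)) = B $$ (i, j)" if "i < ?n" "j < ?n" for i j
      using arg_cong[OF Bh, of "\<lambda>X. X $$ (i, j)"] that B by simp
    have "col (A * W) 0 = e \<cdot>\<^sub>v col W 0"
      using W A Av v colW by (simp add: col_mult2[of _ ?n ?n _ ?n] mult_mat_vec[of _ ?n ?n] del: col_mult)
        (simp add: smult_smult_assoc mult.commute)
    then have "B $$ (i, 0) = e * (mat_adjoint W * W) $$ (i, 0)" if "i < ?n" for i
      unfolding B_def using that W W' A by (simp add: assoc_mult_mat[of _ ?n ?n _ ?n _ ?n] mult_carrier_mat[of _ ?n ?n _ ?n])
    then have B0: "B $$ (i, 0) = (if i = 0 then e else 0)" if "i < ?n" for i
      using that W1 by simp
    have e: "e = complex_of_real (Re e)"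
      using Bh'[of 0 0] B0[of 0] by (simp add: complex_eq_iff)
    define B3 where "B3 = mat m m (\<lambda>(i, j). B $$ (Suc i, Suc j))"
    have B3: "B3 \<in> carrier_mat m m" unfolding B3_def by simp
    have "mat_adjoint B3 = B3"
      using B3 by (intro eq_matI) (auto simp: B3_def Bh')
    then obtain U l where U: "U \<in> carrier_mat m m" and U1: "mat_adjoint U * U = 1\<^sub>m m"
      and B3U: "B3 = U * mat_diag m (\<lambda>i. complex_of_real (l i)) * mat_adjoint U"
      using Suc.IH[OF B3] by auto
    let ?bl = "\<lambda>X Y. four_block_mat X (0\<^sub>m 1 m) (0\<^sub>m m 1) Y"
    let ?l = "case_nat (Re e) l"
    let ?D = "mat_diag ?n (\<lambda>i. complex_of_real (?l i))"
    let ?E = "mat_diag 1 (\<lambda>i. e)"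
    let ?D3 = "mat_diag m (\<lambda>i. complex_of_real (l i))"
    define V where "V = ?bl (1\<^sub>m 1) U"
    have V: "V \<in> carrier_mat ?n ?n"
      unfolding V_def using four_block_carrier_mat[of "1\<^sub>m 1" 1 1 U m m] U by auto
    have V': "mat_adjoint V = ?bl (1\<^sub>m 1) (mat_adjoint U)"
      unfolding V_def using U
      by (subst mat_adjoint_four_block_mat[of _ 1 1 _ m _ m]) (auto intro!: arg_cong2[where f = "\<lambda>X Y. four_block_mat X Y _ _"] eq_matI)
    have V1: "mat_adjoint V * V = 1\<^sub>m ?n"
    proof -
      have "mat_adjoint V * V = ?bl (1\<^sub>m 1) (mat_adjoint U) * ?bl (1\<^sub>m 1) U"
        unfolding V' by (simp add: V_def)
      also have "\<dots> = 1\<^sub>m ?n"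
        using U U1 by (subst mult_four_block_mat[of _ 1 1 _ m _ m _ _ 1 _ m]) auto
      finally show ?thesis .
    qed
    have D: "?D = ?bl ?E ?D3"
      using e by (intro eq_matI) (auto simp: mat_diag_def split: nat.splits)
    have Bbl: "B = ?bl ?E B3"
    proof (rule eq_matI)
      fix i j assume "i < dim_row (?bl ?E B3)" "j < dim_col (?bl ?E B3)"
      then have i: "i < ?n" and j: "j < ?n" using B3 by (auto simp: mat_diag_def)
      show "B $$ (i, j) = ?bl ?E B3 $$ (i, j)"
        using i j B0[of i] B0[of j] Bh'[of i j]
        by (cases i; cases j) (auto simp: B3_def mat_diag_def)
    qed (use B B3 in \<open>auto simp: mat_diag_def\<close>)
    have "V * ?D = ?bl ?E (U * ?D3)"
      unfolding V_def D using U mat_diag_dim[of 1 "\<lambda>i. e"] mat_diag_dim[of m "\<lambda>i. complex_of_real (l i)"]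
      by (subst mult_four_block_mat[of _ 1 1 _ m _ m _ _ 1 _ m])
        (auto simp del: One_nat_def simp: left_mult_one_mat[of _ 1 1] left_mult_zero_mat[of _ m m] left_mult_zero_mat[of _ 1 1])
    then have "V * ?D * mat_adjoint V = ?bl ?E (U * ?D3 * mat_adjoint U)"
      unfolding V' using U mat_diag_dim[of 1 "\<lambda>i. e"] mat_diag_dim[of m "\<lambda>i. complex_of_real (l i)"]
      by (simp del: One_nat_def, subst mult_four_block_mat[of _ 1 1 _ m _ m _ _ 1 _ m])
        (auto simp del: One_nat_def simp: right_mult_one_mat[of _ 1 1] right_mult_zero_mat[of _ m m] right_mult_zero_mat[of _ 1 1]
          left_mult_zero_mat[of _ m m] left_mult_zero_mat[of _ 1 1])
    then have BV: "B = V * ?D * mat_adjoint V"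
      unfolding Bbl B3U by simp
    have "A = W * B * mat_adjoint W"
    proof -
      have "W * B * mat_adjoint W = (W * mat_adjoint W) * A * (W * mat_adjoint W)"
        unfolding B_def using W W' A by (simp add: assoc_mult_mat[of _ ?n ?n _ ?n _ ?n] mult_carrier_mat[of _ ?n ?n _ ?n])
      then show ?thesis using W2 A by simp
    qed
    also have "\<dots> = (W * V) * ?D * mat_adjoint (W * V)"
      unfolding BV using W W' V mat_adjoint_carrier[OF V] mat_diag_dim[of ?n "\<lambda>i. complex_of_real (?l i)"]
      by (simp add: mat_adjoint_mult[of _ ?n ?n _ ?n] assoc_mult_mat[of _ ?n ?n _ ?n _ ?n] mult_carrier_mat[of _ ?n ?n _ ?n])
    finally have "A = (W * V) * ?D * mat_adjoint (W * V)" .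
    moreover have "mat_adjoint (W * V) * (W * V) = mat_adjoint V * ((mat_adjoint W * W) * V)"
      using W W' V mat_adjoint_carrier[OF V]
      by (simp add: mat_adjoint_mult[of _ ?n ?n _ ?n] assoc_mult_mat[of _ ?n ?n _ ?n _ ?n] mult_carrier_mat[of _ ?n ?n _ ?n])
    then have "mat_adjoint (W * V) * (W * V) = 1\<^sub>m ?n"
      using V V1 W1 by simp
    moreover have "W * V \<in> carrier_mat ?n ?n" using W V by simp
    ultimately show ?case by blast
  qed
  then obtain U l where U: "U \<in> carrier_mat n n" "mat_adjoint U * U = 1\<^sub>m n"
    "A = U * mat_diag n (\<lambda>i. complex_of_real (l i)) * mat_adjoint U" by auto
  moreover have "U * mat_adjoint U = 1\<^sub>m n"
    using mat_mult_left_right_inverse[OF mat_adjoint_carrier[OF U(1)] U(1,2)] .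
  ultimately show thesis using that by blast
qed

section \<open>Positive matrices: congruence, eigenvalues and rank-one terms\<close>

lemma sesq_one:
  "x \<in> carrier_vec d \<Longrightarrow> sesq (1\<^sub>m d) x y = x \<bullet>c y"
  unfolding sesq_def by simp

lemma sesq_one_mult_left:
  assumes "A \<in> carrier_mat d d" "x \<in> carrier_vec d"
  shows "sesq (1\<^sub>m d) (A *\<^sub>v x) y = sesq A x y"
  using assms unfolding sesq_def by simp

lemma sesq_hermitian:
  assumes "A \<in> carrier_mat d d" "mat_adjoint A = A" "x \<in> carrier_vec d" "y \<in> carrier_vec d"
  shows "sesq (1\<^sub>m d) x (A *\<^sub>v y) = sesq A x y"
  using sesq_mult_left[of A d "1\<^sub>m d" x y] assms by simp

lemma sesq_congruence:
  assumes "A \<in> carrier_mat d d" "B \<in> carrier_mat d d" "C \<in> carrier_mat d d"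
    "x \<in> carrier_vec d" "y \<in> carrier_vec d"
  shows "sesq (B * A * C) x y = sesq A (C *\<^sub>v x) (mat_adjoint B *\<^sub>v y)"
proof -
  have "sesq (B * A * C) x y = sesq (B * A) (C *\<^sub>v x) y"
    using assms by (intro sesq_mult_right[of _ d]) auto
  also have "\<dots> = sesq A (C *\<^sub>v x) (mat_adjoint B *\<^sub>v y)"
    using assms by (intro sesq_mult_left[of _ d]) auto
  finally show ?thesis .
qed

lemma psd_zero: "psd d (0\<^sub>m d d)"
  by (rule psdI) (auto simp: sesq_sum[of _ d])

lemma psd_add: "psd d A \<Longrightarrow> psd d B \<Longrightarrow> psd d (A + B)"
  by (rule psdI) (auto simp: sesq_add_mat[of _ d] psdD add_nonneg_nonneg)

lemma psd_mat_diag: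
  assumes "\<And>i. i < d \<Longrightarrow> 0 \<le> f i"
  shows "psd d (mat_diag d f)"
proof (rule psdI)
  fix v :: "complex vec" assume v: "v \<in> carrier_vec d"
  have "sesq (mat_diag d f) v v = (\<Sum>i<d. \<Sum>j<d. mat_diag d f $$ (i, j) * v $ j * cnj (v $ i))"
    using v by (subst sesq_sum[of _ d]) auto
  also have "\<dots> = (\<Sum>i<d. \<Sum>j<d. if j = i then f i * (v $ i * cnj (v $ i)) else 0)"
    by (intro sum.cong refl) (auto simp: mat_diag_def)
  also have "\<dots> = (\<Sum>i<d. f i * (v $ i * cnj (v $ i)))"
    by simp
  also have "0 \<le> \<dots>"
    using assms by (intro sum_nonneg mult_nonneg_nonneg[OF _ conjugate_square_positive[where 'a = complex, simplified]]) auto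
  finally show "0 \<le> sesq (mat_diag d f) v v" .
qed auto

lemma mat_adjoint_mat_diag: "mat_adjoint (mat_diag d f) = mat_diag d (\<lambda>i. cnj (f i))"
  by (intro eq_matI) (auto simp: mat_diag_def)

lemma mtrace_mult:
  assumes "A \<in> carrier_mat d d" "B \<in> carrier_mat d d"
  shows "mtrace (A * B) = (\<Sum>i<d. \<Sum>j<d. A $$ (i, j) * B $$ (j, i))"
  using assms unfolding mtrace_def by (simp add: scalar_prod_def atLeast0LessThan)

lemma psd_spectral:
  assumes "psd d A"
  obtains U l where "U \<in> carrier_mat d d" "mat_adjoint U * U = 1\<^sub>m d" "U * mat_adjoint U = 1\<^sub>m d"
    "A = U * mat_diag d (\<lambda>i. complex_of_real (l i)) * mat_adjoint U" "\<And>i. i < d \<Longrightarrow> 0 \<le> l i"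
proof -
  note A = psdD(1)[OF assms]
  obtain U l where U: "U \<in> carrier_mat d d" "mat_adjoint U * U = 1\<^sub>m d" "U * mat_adjoint U = 1\<^sub>m d"
    and AU: "A = U * mat_diag d (\<lambda>i. complex_of_real (l i)) * mat_adjoint U"
    using hermitian_spectral[OF A psd_hermitian[OF assms]] .
  let ?D = "mat_diag d (\<lambda>i. complex_of_real (l i))"
  have "mat_adjoint U * A * U = (mat_adjoint U * U) * ?D * (mat_adjoint U * U)"
    unfolding AU using U(1) mat_adjoint_carrier[OF U(1)] mat_diag_dim[of d "\<lambda>i. complex_of_real (l i)"]
    by (simp add: assoc_mult_mat[of _ d d _ d _ d] mult_carrier_mat[of _ d d _ d])
  then have "mat_adjoint U * A * U = ?D"
    using U(2) by (simp add: left_mult_one_mat[of _ d d] right_mult_one_mat[of _ d d])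
  then have "psd d ?D"
    using psd_congruence[OF assms U(1)] by simp
  have "0 \<le> l i" if "i < d" for i
    using psdD(2)[OF \<open>psd d ?D\<close>, of "unit_vec d i"] that
    by (simp add: sesq_unit_vec mat_diag_def less_eq_complex_def)
  then show thesis using that U AU by blast
qed

text \<open>The vectors are eigenvectors scaled by the roots of their eigenvalues, zero vectors
  included. This reduces claims about a positive matrix, be it a state, a test or a tensor factor,
  to claims about single vectors.\<close>

lemma psd_rank_one_sum:
  assumes "psd d A"
  obtains s where "\<And>k. s k \<in> carrier_vec d"
    "\<And>i j. i < d \<Longrightarrow> j < d \<Longrightarrow> A $$ (i, j) = (\<Sum>k<d. s k $ i * cnj (s k $ j))"
proof -
  obtain U l where U: "U \<in> carrier_mat d d"
    and AU: "A = U * mat_diag d (\<lambda>i. complex_of_real (l i)) * mat_adjoint U"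
    and l: "\<And>i. i < d \<Longrightarrow> 0 \<le> l i"
    using psd_spectral[OF assms] by metis
  define s where "s k = vec d (\<lambda>i. complex_of_real (sqrt (l k)) * U $$ (i, k))" for k
  have "A $$ (i, j) = (\<Sum>k<d. s k $ i * cnj (s k $ j))" if "i < d" "j < d" for i j
  proof -
    have "A $$ (i, j) = (\<Sum>k<d. U $$ (i, k) * complex_of_real (l k) * cnj (U $$ (j, k)))"
      unfolding AU using that U mat_adjoint_carrier[OF U]
      by (simp add: mat_diag_mult_right[OF U] scalar_prod_def atLeast0LessThan)
    also have "\<dots> = (\<Sum>k<d. s k $ i * cnj (s k $ j))"
    proof (intro sum.cong refl)
      fix k assume "k \<in> {..<d}"
      then have "complex_of_real (l k) = complex_of_real (sqrt (l k)) * complex_of_real (sqrt (l k))"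
        using l by (simp flip: of_real_mult)
      then show "U $$ (i, k) * complex_of_real (l k) * cnj (U $$ (j, k)) = s k $ i * cnj (s k $ j)"
        using that by (simp add: s_def)
    qed
    finally show ?thesis .
  qed
  then show thesis using that[of s] by (auto simp: s_def)
qed

text \<open>Each rank-one term of \<open>A\<close> contributes one value of the quadratic form of
  \<open>X\<close>, so inequalities between forms become inequalities between expectation
  values.\<close>

lemma mtrace_mult_rank_one_sum:
  assumes "X \<in> carrier_mat d d" "A \<in> carrier_mat d d" "\<And>k. s k \<in> carrier_vec d"
    "\<And>i j. i < d \<Longrightarrow> j < d \<Longrightarrow> A $$ (i, j) = (\<Sum>k<d. s k $ i * cnj (s k $ j))"
  shows "mtrace (X * A) = (\<Sum>k<d. sesq X (s k) (s k))"
proof -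
  have "mtrace (X * A) = (\<Sum>i<d. \<Sum>j<d. \<Sum>k<d. X $$ (i, j) * s k $ j * cnj (s k $ i))"
    unfolding mtrace_mult[OF assms(1,2)]
    using assms(4) by (intro sum.cong refl) (simp add: sum_distrib_left mult.assoc)
  also have "\<dots> = (\<Sum>i<d. \<Sum>k<d. \<Sum>j<d. X $$ (i, j) * s k $ j * cnj (s k $ i))"
    by (intro sum.cong refl sum.swap)
  also have "\<dots> = (\<Sum>k<d. \<Sum>i<d. \<Sum>j<d. X $$ (i, j) * s k $ j * cnj (s k $ i))"
    by (rule sum.swap)
  also have "\<dots> = (\<Sum>k<d. sesq X (s k) (s k))"
    using assms by (intro sum.cong refl) (simp add: sesq_sum[of _ d])
  finally show ?thesis .
qed

text \<open>Since \<open>S\<^sup>2 \<le> S\<close>, this is operator monotonicity of the square root applied to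
  \<open>S\<^sup>2 \<le> G\<^sup>2\<close>; it is read off an eigenvector of \<open>G - S\<close> with a negative eigenvalue.\<close>

lemma psd_minus_of_square:
  assumes G: "psd d G" and S: "psd d S" and S1: "psd d (1\<^sub>m d - S)" and GS: "psd d (G * G - S)"
  shows "psd d (G - S)"
proof -
  note cG = psdD(1)[OF G] and cS = psdD(1)[OF S]
  have c: "G - S \<in> carrier_mat d d" using minus_carrier_mat[OF cS] .
  note hG = psd_hermitian[OF G] and hS = psd_hermitian[OF S]
  have GSij: "cnj (G $$ (j, i)) = G $$ (i, j)" "cnj (S $$ (j, i)) = S $$ (i, j)" if "i < d" "j < d" for i j
    using arg_cong[OF hG, of "\<lambda>X. X $$ (i, j)"] arg_cong[OF hS, of "\<lambda>X. X $$ (i, j)"] that cG cS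
    by auto
  have h: "mat_adjoint (G - S) = G - S"
    using cG cS GSij by (intro eq_matI) auto
  obtain U l where U: "U \<in> carrier_mat d d" "mat_adjoint U * U = 1\<^sub>m d" "U * mat_adjoint U = 1\<^sub>m d"
    and HU: "G - S = U * mat_diag d (\<lambda>i. complex_of_real (l i)) * mat_adjoint U"
    using hermitian_spectral[OF c h] .
  let ?D = "mat_diag d (\<lambda>i. complex_of_real (l i))"
  have "0 \<le> l k" if k: "k < d" for k
  proof (rule ccontr)
    assume neg: "\<not> 0 \<le> l k"
    \<comment> \<open>A unit eigenvector for the supposedly negative eigenvalue. It satisfies
      \<open>G v = S v + l k v\<close>, so everything below is expressed through
      \<open>y = S v\<close>, \<open>s\<close> and \<open>l k\<close>.\<close>
    define v where "v = col U k"
    have v: "v \<in> carrier_vec d" unfolding v_def using U(1) by auto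
    have "(G - S) * U = U * ?D * (mat_adjoint U * U)"
      unfolding HU using U(1) mat_adjoint_carrier[OF U(1)] mat_diag_dim[of d "\<lambda>i. complex_of_real (l i)"]
      by (simp add: assoc_mult_mat[of _ d d _ d _ d] mult_carrier_mat[of _ d d _ d])
    also have "\<dots> = U * ?D"
      using U by (simp add: right_mult_one_mat[of _ d d] mult_carrier_mat[of _ d d _ d])
    finally have "col ((G - S) * U) k = col (U * ?D) k"
      by simp
    also have "\<dots> = complex_of_real (l k) \<cdot>\<^sub>v v"
      unfolding v_def mat_diag_mult_right[OF U(1)] using U(1) k by (intro eq_vecI) auto
    finally have "(G - S) *\<^sub>v v = complex_of_real (l k) \<cdot>\<^sub>v v"
      using c U(1) k unfolding v_def by (simp add: col_mult2[of _ d d _ d] del: col_mult)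
    then have "G *\<^sub>v v - S *\<^sub>v v = complex_of_real (l k) \<cdot>\<^sub>v v"
      using cG cS v by (simp add: minus_mult_distrib_mat_vec[of _ d d])
    then have *: "(G *\<^sub>v v - S *\<^sub>v v) $ i = (complex_of_real (l k) \<cdot>\<^sub>v v) $ i" for i
      by simp
    have "(G *\<^sub>v v) $ i = (S *\<^sub>v v) $ i + complex_of_real (l k) * v $ i" if "i < d" for i
      using *[of i] that cG cS v by (simp add: algebra_simps)
    then have Gv: "G *\<^sub>v v = S *\<^sub>v v + complex_of_real (l k) \<cdot>\<^sub>v v"
      using cG cS v by (intro eq_vecI) (auto simp del: index_mult_mat_vec)
    have vv: "sesq (1\<^sub>m d) v v = 1"
    proof -
      have "(mat_adjoint U * U) $$ (k, k) = (\<Sum>i<d. cnj (U $$ (i, k)) * U $$ (i, k))"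
        using U(1) k by (simp add: scalar_prod_def atLeast0LessThan)
      also have "\<dots> = v \<bullet>c v"
        using U(1) k unfolding v_def by (auto simp: scalar_prod_def atLeast0LessThan intro!: sum.cong)
      finally show ?thesis
        using U(2) k sesq_one[OF v, of v] by simp
    qed
    define y where "y = S *\<^sub>v v"
    have y: "y \<in> carrier_vec d" unfolding y_def using cS v by simp
    let ?J = "sesq (1\<^sub>m d)"
    have yv: "?J y v = sesq S v v" unfolding y_def using sesq_one_mult_left[OF cS v] .
    have vy: "?J v y = sesq S v v" unfolding y_def using sesq_hermitian[OF cS hS v v] .
    define s where "s = Re (sesq S v v)"
    have s: "sesq S v v = complex_of_real s" and s0: "0 \<le> s"
      using psdD(2)[OF S v] unfolding s_def by (auto simp: less_eq_complex_def complex_eq_iff)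
    have Sy1: "?J (S *\<^sub>v y) v = ?J y y"
      using sesq_one_mult_left[OF cS y] sesq_hermitian[OF cS hS y v] by (simp add: y_def)
    \<comment> \<open>This is S^2 \<le> S tested at \<open>v\<close>, from S - S^2 = S (1 - S) S +
      (1 - S) S (1 - S), where both terms are visibly positive.\<close>
    have "0 \<le> sesq (1\<^sub>m d - S) y y + sesq S (v - y) (v - y)"
      using psdD(2)[OF S1 y] psdD(2)[OF S, of "v - y"] y v by (simp add: add_nonneg_nonneg)
    also have "\<dots> = sesq S v v - ?J y y"
    proof -
      have "sesq S y v = ?J y y" "sesq S v y = ?J y y"
        using sesq_hermitian[OF cS hS y v] sesq_one_mult_left[OF cS v] by (auto simp: y_def)
      then show ?thesis
        using cS y v
        by (simp add: sesq_minus_mat[of _ d] sesq_minus_left[of _ d] sesq_minus_right[of _ d])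
    qed
    finally have SS: "Re (?J y y) \<le> s"
      unfolding s by (simp add: less_eq_complex_def)
    have Gvv: "sesq G v v = complex_of_real (s + l k)"
      using sesq_one_mult_left[OF cG v, of v] unfolding Gv
      using v y yv vv s
      by (simp flip: y_def add: sesq_add_left[of _ d] sesq_smult_left[of _ d])
    have "sesq (G * G) v v = ?J (G *\<^sub>v v) (G *\<^sub>v v)"
      using cG v sesq_mult_right[OF cG cG v] sesq_hermitian[OF cG hG, of "G *\<^sub>v v" v] by simp
    also have "\<dots> = ?J y y + 2 * complex_of_real (l k * s) + complex_of_real (l k * l k)"
      unfolding Gv using v y yv vy vv s
      by (simp flip: y_def add: sesq_add_left[of _ d] sesq_smult_left[of _ d]
          sesq_add_right[of _ d] sesq_smult_right[of _ d] algebra_simps)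
    finally have "sesq (G * G) v v = ?J y y + 2 * complex_of_real (l k * s) + complex_of_real (l k * l k)" .
    then have "Re (?J y y) + 2 * (l k * s) + l k * l k - s \<ge> 0"
      using psdD(2)[OF GS v] cG cS v s by (simp add: sesq_minus_mat[of _ d] less_eq_complex_def)
    \<comment> \<open>For negative \<open>l k\<close> this forces 2 s + l k \<le> 0. Positivity of
      \<open>G\<close> at \<open>v\<close> gives s + l k \<ge> 0, hence s > 0 and 2 s + l k \<ge> s
      > 0, a contradiction.\<close>
    with SS have "0 \<le> l k * (2 * s + l k)"
      by (simp add: algebra_simps)
    moreover have "0 \<le> s + l k"
      using psdD(2)[OF G v] Gvv by (simp add: less_eq_complex_def)
    ultimately show False
      using neg by (simp add: zero_le_mult_iff)
  qed
  then have "psd d ?D"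
    by (intro psd_mat_diag) (auto simp: less_eq_complex_def)
  from psd_congruence[OF this mat_adjoint_carrier[OF U(1)]]
  show ?thesis unfolding HU by simp
qed

section \<open>The pretty good measurement and the Hayashi--Nagaoka inequality\<close>

text \<open>Functional calculus in one eigenbasis: \<open>W\<close>, \<open>G\<close> and
  \<open>P\<close> are the inverse root (with value 0 at eigenvalue 0), the root and the indicator
  of a nonzero eigenvalue, so every identity is a scalar one checked at \<open>l i\<close>. Since
  \<open>M\<close> may be singular, \<open>W * M * W\<close> is only the support projection.\<close>

lemma psd_pseudo_inverse_sqrt:
  assumes "psd d M"
  obtains W G P where "W \<in> carrier_mat d d" "mat_adjoint W = W" "psd d G" "psd d (1\<^sub>m d - P)"
    "P \<in> carrier_mat d d" "W * M * W = P" "W * M = G" "M * W = G" "G * G = M"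
proof -
  obtain U l where U: "U \<in> carrier_mat d d" "mat_adjoint U * U = 1\<^sub>m d" "U * mat_adjoint U = 1\<^sub>m d"
    and MU: "M = U * mat_diag d (\<lambda>i. complex_of_real (l i)) * mat_adjoint U"
    and l: "\<And>i. i < d \<Longrightarrow> 0 \<le> l i"
    using psd_spectral[OF assms] by metis
  define h where "h f = U * mat_diag d (\<lambda>i. complex_of_real (f i)) * mat_adjoint U" for f :: "nat \<Rightarrow> real"
  have h: "h f \<in> carrier_mat d d" for f
    unfolding h_def using U(1) by (simp add: mult_carrier_mat[of _ d d _ d])
  have hadj: "mat_adjoint (h f) = h f" for f
    unfolding h_def using U(1)
    by (simp add: mat_adjoint_mult[of _ d d _ d] mat_adjoint_mat_diag assoc_mult_mat[of _ d d _ d _ d]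
        mult_carrier_mat[of _ d d _ d])
  have hmult: "h f * h g = h (\<lambda>i. f i * g i)" for f g
  proof -
    have "h f * h g = U * (mat_diag d (\<lambda>i. complex_of_real (f i)) * (mat_adjoint U * U)
        * mat_diag d (\<lambda>i. complex_of_real (g i))) * mat_adjoint U"
      unfolding h_def using U(1)
      by (simp add: assoc_mult_mat[of _ d d _ d _ d] mult_carrier_mat[of _ d d _ d])
    then show ?thesis
      unfolding U(2) h_def using U(1) by (simp add: right_mult_one_mat[of _ d d])
  qed
  have hcong: "h f = h g" if "\<And>i. i < d \<Longrightarrow> f i = g i" for f g
  proof -
    have "mat_diag d (\<lambda>i. complex_of_real (f i)) = mat_diag d (\<lambda>i. complex_of_real (g i))"
      using that by (intro eq_matI) (auto simp: mat_diag_def)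
    then show ?thesis by (simp add: h_def)
  qed
  have hpsd: "psd d (h f)" if "\<And>i. i < d \<Longrightarrow> 0 \<le> f i" for f
    using psd_congruence[OF psd_mat_diag mat_adjoint_carrier[OF U(1)], of "\<lambda>i. complex_of_real (f i)"] that
    unfolding h_def by (simp add: less_eq_complex_def)
  have hone: "h (\<lambda>i. 1) = 1\<^sub>m d"
    unfolding h_def using U by (simp add: right_mult_one_mat[of _ d d])
  have hminus: "h (\<lambda>i. f i - g i) = h f - h g" for f g
  proof -
    have "mat_diag d (\<lambda>i. complex_of_real (f i - g i)) =
        mat_diag d (\<lambda>i. complex_of_real (f i)) - mat_diag d (\<lambda>i. complex_of_real (g i))"
      by (intro eq_matI) (auto simp: mat_diag_def)
    then show ?thesis
      unfolding h_def using U(1)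
      by (simp add: mult_minus_distrib_mat[of _ d d _ d] minus_mult_distrib_mat[of _ d d _ _ d]
          mult_carrier_mat[of _ d d _ d])
  qed
  define w where "w i = (if l i = 0 then 0 else 1 / sqrt (l i))" for i
  define p where "p i = (if l i = 0 then 0 else 1 :: real)" for i
  have w2: "w i * l i = sqrt (l i)" if "i < d" for i
    using l[OF that] by (simp add: w_def real_div_sqrt)
  have M: "M = h l" using MU by (simp add: h_def)
  show thesis
  proof (rule that)
    show "h w \<in> carrier_mat d d" "h p \<in> carrier_mat d d" by (rule h)+
    show "mat_adjoint (h w) = h w" by (rule hadj)
    show "psd d (h (\<lambda>i. sqrt (l i)))" using l by (intro hpsd) auto
    have "psd d (h (\<lambda>i. 1 - p i))" by (intro hpsd) (auto simp: p_def)
    then show "psd d (1\<^sub>m d - h p)" by (simp add: hminus hone)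
    show "h w * M * h w = h p"
      unfolding M hmult using l by (intro hcong) (simp add: w2, simp add: w_def p_def)
    show "h w * M = h (\<lambda>i. sqrt (l i))"
      unfolding M hmult by (intro hcong) (rule w2)
    show "M * h w = h (\<lambda>i. sqrt (l i))"
      unfolding M hmult by (intro hcong) (subst mult.commute, rule w2)
    show "h (\<lambda>i. sqrt (l i)) * h (\<lambda>i. sqrt (l i)) = M"
      unfolding M hmult using l by (intro hcong) auto
  qed
qed

text \<open>The gap in the Hayashi--Nagaoka inequality is a sum of four positive terms:
  \<open>2 (1 - S) + 4 T - (1 - W S W) = (1 - P) + 4 (G - S) + 2 (W - 1) S (W - 1) + (W - 2) T (W - 2)\<close>,
  where \<open>W = M\<^sup>-\<^sup>1\<^sup>/\<^sup>2\<close>, \<open>G = M\<^sup>1\<^sup>/\<^sup>2\<close> and \<open>P\<close> is the support projection of \<open>M = S + T\<close>.\<close>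

lemma hayashi_nagaoka:
  assumes S: "psd d S" and S1: "psd d (1\<^sub>m d - S)" and T: "psd d T"
    and W: "W \<in> carrier_mat d d" "mat_adjoint W = W" and G: "psd d G" and P: "psd d (1\<^sub>m d - P)"
    and cP: "P \<in> carrier_mat d d"
    and eqs: "W * (S + T) * W = P" "W * (S + T) = G" "(S + T) * W = G" "G * G = S + T"
    and v: "v \<in> carrier_vec d"
  shows "Re (v \<bullet>c v) - 2 * (Re (v \<bullet>c v) - Re (sesq S v v)) - 4 * Re (sesq T v v)
    \<le> Re (sesq S (W *\<^sub>v v) (W *\<^sub>v v))"
proof -
  define M where "M = S + T"
  note cS = psdD(1)[OF S] and cT = psdD(1)[OF T] and cG = psdD(1)[OF G]
  have cM: "M \<in> carrier_mat d d" unfolding M_def using cS cT by simp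
  \<comment> \<open>G^2 - S is the positive operator \<open>T\<close>; together with S \<le> 1 this
    yields S \<le> G.\<close>
  have "G * G - S = T"
    unfolding eqs using cS cT by (intro eq_matI) auto
  then have GS: "psd d (G - S)"
    using psd_minus_of_square[OF G S S1] T by simp
  define w where "w = W *\<^sub>v v"
  have w: "w \<in> carrier_vec d" unfolding w_def using W v by simp
  have "sesq P v v = sesq M w w"
    unfolding eqs(1)[symmetric] w_def M_def[symmetric] using W v cM
    by (simp add: sesq_congruence[of _ d] del: assoc_mult_mat)
  then have Pvv: "sesq P v v = sesq S w w + sesq T w w"
    unfolding M_def using cS cT w by (simp add: sesq_add_mat[of _ d])
  have "sesq G v v = sesq M w v"
    unfolding eqs(3)[symmetric] w_def M_def[symmetric] using W v cM
    by (simp add: sesq_mult_right[of _ d])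
  then have Gwv: "sesq G v v = sesq S w v + sesq T w v"
    unfolding M_def using cS cT w v by (simp add: sesq_add_mat[of _ d])
  have "sesq G v v = sesq M v w"
    unfolding eqs(2)[symmetric] w_def M_def[symmetric] using W v cM
    by (simp add: sesq_mult_left[of _ d])
  then have Gvw: "sesq G v v = sesq S v w + sesq T v w"
    unfolding M_def using cS cT w v by (simp add: sesq_add_mat[of _ d])
  \<comment> \<open>\<open>r1\<close> to \<open>r4\<close> are the four positive terms tested at
    \<open>v\<close>, with \<open>w = W v\<close>; they are added with weights 1, 4, 2, 1. The term
    4 G is split evenly into 2 W M + 2 M W to cancel the cross terms, which is why \<open>G\<close>
    is expanded both as \<open>Gwv\<close> and as \<open>Gvw\<close>.\<close>
  have r1: "0 \<le> Re (v \<bullet>c v - sesq P v v)"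
    using psdD(2)[OF P v] cP v
    by (simp add: sesq_minus_mat[of _ d] sesq_one less_eq_complex_def)
  have r2: "0 \<le> Re (sesq G v v - sesq S v v)"
    using psdD(2)[OF GS v] cG cS v by (simp add: sesq_minus_mat[of _ d] less_eq_complex_def)
  have r3: "0 \<le> Re (sesq S w w - sesq S w v - sesq S v w + sesq S v v)"
    using psdD(2)[OF S, of "w - v"] cS v w
    by (simp add: sesq_minus_left[of _ d] sesq_minus_right[of _ d] less_eq_complex_def algebra_simps)
  have r4: "0 \<le> Re (sesq T w w - 2 * sesq T w v - 2 * sesq T v w + 4 * sesq T v v)"
    using psdD(2)[OF T, of "w - 2 \<cdot>\<^sub>v v"] cT v w
    by (simp add: sesq_minus_left[of _ d] sesq_minus_right[of _ d] sesq_smult_left[of _ d]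
        sesq_smult_right[of _ d] less_eq_complex_def algebra_simps)
  from r1 r2 r3 r4 show ?thesis
    unfolding w_def[symmetric] Pvv
    using arg_cong[OF Gwv, of Re] arg_cong[OF Gvw, of Re] by simp
qed

text \<open>Finite operator sums are formed entry by entry at a stated dimension, so that the empty
  sum is the zero matrix of the right size.\<close>

lemma sesq_mat_sum:
  assumes "\<And>i. i \<in> J \<Longrightarrow> F i \<in> carrier_mat d d" "x \<in> carrier_vec d" "y \<in> carrier_vec d"
  shows "sesq (mat d d (\<lambda>x. \<Sum>i\<in>J. F i $$ x)) x y = (\<Sum>i\<in>J. sesq (F i) x y)"
proof -
  let ?M = "mat d d (\<lambda>x. \<Sum>i\<in>J. F i $$ x)"
  have c: "?M \<in> carrier_mat d d" by simp
  have "sesq ?M x y = (\<Sum>a<d. \<Sum>b<d. \<Sum>i\<in>J. F i $$ (a, b) * x $ b * cnj (y $ a))"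
    unfolding sesq_sum[OF c assms(2,3)] by (intro sum.cong refl) (simp add: sum_distrib_right)
  also have "\<dots> = (\<Sum>a<d. \<Sum>i\<in>J. \<Sum>b<d. F i $$ (a, b) * x $ b * cnj (y $ a))"
    by (intro sum.cong refl sum.swap)
  also have "\<dots> = (\<Sum>i\<in>J. \<Sum>a<d. \<Sum>b<d. F i $$ (a, b) * x $ b * cnj (y $ a))"
    by (rule sum.swap)
  also have "\<dots> = (\<Sum>i\<in>J. sesq (F i) x y)"
    using assms by (intro sum.cong refl) (auto simp: sesq_sum[of _ d])
  finally show ?thesis .
qed

lemma psd_mat_sum:
  assumes "\<And>i. i \<in> J \<Longrightarrow> psd d (F i)"
  shows "psd d (mat d d (\<lambda>x. \<Sum>i\<in>J. F i $$ x))"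
  using psdD(1)[OF assms] psdD(2)[OF assms] by (intro psdI) (auto simp: sesq_mat_sum intro!: sum_nonneg)

text \<open>The operator-form error bound is Hayashi-Nagaoka with \<open>F i\<close> as the correct
  test and the sum of all other tests as the disturbance. Both add up to the same \<open>M I\<close>
  whichever i is correct, so one \<open>W\<close> serves all outcomes.\<close>

lemma pretty_good_measurement:
  assumes "finite I" "i0 \<in> I" and F: "\<And>i. i \<in> I \<Longrightarrow> psd d (F i)"
    and F1: "\<And>i. i \<in> I \<Longrightarrow> psd d (1\<^sub>m d - F i)"
  obtains L where "\<And>i. i \<in> I \<Longrightarrow> psd d (L i)"
    "\<And>a b. a < d \<Longrightarrow> b < d \<Longrightarrow> (\<Sum>i\<in>I. L i $$ (a, b)) = 1\<^sub>m d $$ (a, b)"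
    "\<And>i v. i \<in> I \<Longrightarrow> v \<in> carrier_vec d \<Longrightarrow>
      Re (v \<bullet>c v) - 2 * (Re (v \<bullet>c v) - Re (sesq (F i) v v)) - 4 * (\<Sum>j\<in>I - {i}. Re (sesq (F j) v v))
      \<le> Re (sesq (L i) v v)"
proof -
  define M where "M J = mat d d (\<lambda>x. \<Sum>i\<in>J. F i $$ x)" for J
  have cM: "M J \<in> carrier_mat d d" for J unfolding M_def by simp
  note cF = psdD(1)[OF F]
  have sM: "sesq (M J) x y = (\<Sum>i\<in>J. sesq (F i) x y)"
    if "J \<subseteq> I" "x \<in> carrier_vec d" "y \<in> carrier_vec d" for J x y
    unfolding M_def using that cF by (intro sesq_mat_sum) auto
  have pM: "psd d (M J)" if "J \<subseteq> I" for J
    unfolding M_def using that F by (intro psd_mat_sum) auto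
  obtain W G P where W: "W \<in> carrier_mat d d" "mat_adjoint W = W" and G: "psd d G"
    and P: "psd d (1\<^sub>m d - P)" and cP: "P \<in> carrier_mat d d"
    and eqs: "W * M I * W = P" "W * M I = G" "M I * W = G" "G * G = M I"
    using psd_pseudo_inverse_sqrt[OF pM[OF subset_refl]] .
  \<comment> \<open>The operators \<open>W * F i * W\<close> add up to \<open>P\<close> only. The
    defect 1 - P is positive and is credited to the outcome \<open>i0\<close>, whose probability can
    only grow.\<close>
  define Q where "Q i = (if i = i0 then 1\<^sub>m d - P else 0\<^sub>m d d)" for i
  have pQ: "psd d (Q i)" for i unfolding Q_def using P psd_zero by simp
  define L where "L i = W * F i * W + Q i" for i
  have sW: "sesq (W * A * W) x y = sesq A (W *\<^sub>v x) (W *\<^sub>v y)"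
    if "A \<in> carrier_mat d d" "x \<in> carrier_vec d" "y \<in> carrier_vec d" for A x y
    using W that by (simp add: sesq_congruence[of _ d] del: assoc_mult_mat)
  have "psd d (L i)" if "i \<in> I" for i
    unfolding L_def using psd_congruence[OF F[OF that] W(1)] W(2) pQ psd_add by simp
  moreover have "(\<Sum>i\<in>I. L i $$ (a, b)) = 1\<^sub>m d $$ (a, b)" if "a < d" "b < d" for a b
  proof -
    let ?a = "unit_vec d a" and ?b = "unit_vec d b"
    have "(\<Sum>i\<in>I. (W * F i * W) $$ (a, b)) = (\<Sum>i\<in>I. sesq (F i) (W *\<^sub>v ?b) (W *\<^sub>v ?a))"
      using that W cF
      by (intro sum.cong refl) (simp flip: sW add: sesq_unit_vec[of _ d] mult_carrier_mat[of _ d d _ d])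
    also have "\<dots> = sesq (W * M I * W) ?b ?a"
      using that W cM by (simp add: sM sW del: assoc_mult_mat)
    also have "\<dots> = P $$ (a, b)"
      unfolding eqs(1) using that by (simp add: sesq_unit_vec[OF cP])
    finally have *: "(\<Sum>i\<in>I. (W * F i * W) $$ (a, b)) = P $$ (a, b)" .
    have "(\<Sum>i\<in>I. L i $$ (a, b)) = (\<Sum>i\<in>I. (W * F i * W) $$ (a, b) + Q i $$ (a, b))"
      using that carrier_matD[OF psdD(1)[OF pQ]] by (simp add: L_def)
    also have "\<dots> = P $$ (a, b) + (\<Sum>i\<in>I. Q i $$ (a, b))"
      by (simp only: sum.distrib *)
    also have "(\<Sum>i\<in>I. Q i $$ (a, b)) = (\<Sum>i\<in>I. if i = i0 then (1\<^sub>m d - P) $$ (a, b) else 0)"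
      using that by (intro sum.cong refl) (auto simp: Q_def)
    also have "\<dots> = (1\<^sub>m d - P) $$ (a, b)"
      using assms(1,2) by simp
    finally show ?thesis
      using that cP by simp
  qed
  moreover have "Re (v \<bullet>c v) - 2 * (Re (v \<bullet>c v) - Re (sesq (F i) v v)) - 4 * (\<Sum>j\<in>I - {i}. Re (sesq (F j) v v))
      \<le> Re (sesq (L i) v v)" if i: "i \<in> I" and v: "v \<in> carrier_vec d" for i v
  proof -
    have MI: "M I = F i + M (I - {i})"
      using i cF[OF i] assms(1) by (intro eq_matI) (auto simp: M_def sum.remove)
    have "Re (v \<bullet>c v) - 2 * (Re (v \<bullet>c v) - Re (sesq (F i) v v)) - 4 * Re (sesq (M (I - {i})) v v)
      \<le> Re (sesq (F i) (W *\<^sub>v v) (W *\<^sub>v v))"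
      using hayashi_nagaoka[OF F[OF i] F1[OF i] pM W G P cP _ _ _ _ v] eqs unfolding MI by simp
    also have "\<dots> \<le> Re (sesq (L i) v v)"
      unfolding L_def using sesq_add_mat[of "W * F i * W" d "Q i" v v] cF[OF i] W psdD[OF pQ] v
      by (simp add: sW mult_carrier_mat[of _ d d _ d] less_eq_complex_def del: assoc_mult_mat)
    finally show ?thesis
      by (simp add: sM v)
  qed
  ultimately show thesis by (rule that)
qed

section \<open>Tensor products, blocks and measure-and-prepare channels\<close>

lemma pair_index_less:
  fixes a p :: nat
  assumes "a < d" "p < n"
  shows "a * n + p < d * n"
proof -
  have "a * n + p < Suc a * n" using assms by simp
  also have "\<dots> \<le> d * n" using assms by (intro mult_le_mono1) simp
  finally show ?thesis .
qed

lemma sum_pair_index: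
  fixes f :: "nat \<Rightarrow> 'a :: comm_monoid_add"
  shows "(\<Sum>i<d * n. f i) = (\<Sum>a<d. \<Sum>p<n. f (a * n + p))"
proof -
  have "(\<Sum>p<n. f (a * n + p)) = sum f {a * n..<a * n + n}" for a
    using sum.shift_bounds_nat_ivl[of f 0 "a * n" n] by (simp add: add.commute atLeast0LessThan)
  then show ?thesis by (simp add: sum.nat_group)
qed

text \<open>Moves the indices of the second system outside, where block-diagonal operators reduce
  the double sum to \<open>p = q\<close>.\<close>

lemma sum_swap_pairs:
  fixes g :: "nat \<Rightarrow> nat \<Rightarrow> nat \<Rightarrow> nat \<Rightarrow> 'a :: comm_monoid_add"
  shows "(\<Sum>a<d. \<Sum>p<n. \<Sum>b<d. \<Sum>q<n. g a p b q) = (\<Sum>p<n. \<Sum>q<n. \<Sum>a<d. \<Sum>b<d. g a p b q)"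
proof -
  have "(\<Sum>a<d. \<Sum>p<n. \<Sum>b<d. \<Sum>q<n. g a p b q) = (\<Sum>p<n. \<Sum>a<d. \<Sum>b<d. \<Sum>q<n. g a p b q)"
    by (rule sum.swap)
  also have "\<dots> = (\<Sum>p<n. \<Sum>a<d. \<Sum>q<n. \<Sum>b<d. g a p b q)"
    by (intro sum.cong refl sum.swap)
  also have "\<dots> = (\<Sum>p<n. \<Sum>q<n. \<Sum>a<d. \<Sum>b<d. g a p b q)"
    by (intro sum.cong refl sum.swap)
  finally show ?thesis .
qed

lemma eq_mat_pairs:
  assumes "A \<in> carrier_mat (d * n) (d * n)" "B \<in> carrier_mat (d * n) (d * n)"
    "\<And>a b p q. a < d \<Longrightarrow> b < d \<Longrightarrow> p < n \<Longrightarrow> q < n \<Longrightarrow>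
      A $$ (a * n + p, b * n + q) = B $$ (a * n + p, b * n + q)"
  shows "A = B"
proof (rule eq_matI)
  fix i j assume "i < dim_row B" "j < dim_col B"
  then have ij: "i < d * n" "j < d * n" using assms by auto
  then have "n > 0" by (cases n) auto
  show "A $$ (i, j) = B $$ (i, j)"
    using assms(3)[of "i div n" "j div n" "i mod n" "j mod n"] ij \<open>n > 0\<close>
    by (simp add: less_mult_imp_div_less)
qed (use assms in auto)

lemma sesq_pairs:
  assumes "X \<in> carrier_mat (d * n) (d * n)" "v \<in> carrier_vec (d * n)" "w \<in> carrier_vec (d * n)"
  shows "sesq X v w = (\<Sum>p<n. \<Sum>q<n. \<Sum>a<d. \<Sum>b<d.
    X $$ (a * n + p, b * n + q) * v $ (b * n + q) * cnj (w $ (a * n + p)))"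
  unfolding sesq_sum[OF assms] sum_pair_index by (rule sum_swap_pairs)

text \<open>The operator \<open><p| X |q>\<close> on the first system, with p and q in the second:
  exactly the argument that \<open>on_first\<close> hands to the channel.\<close>

definition block :: "nat \<Rightarrow> nat \<Rightarrow> complex mat \<Rightarrow> nat \<Rightarrow> nat \<Rightarrow> complex mat" where
  "block d n X p q = mat d d (\<lambda>(k, l). X $$ (k * n + p, l * n + q))"

lemma block_carrier[simp]: "block d n X p q \<in> carrier_mat d d"
  unfolding block_def by simp

lemma block_dim[simp]: "dim_row (block d n X p q) = d" "dim_col (block d n X p q) = d"
  unfolding block_def by simp_all

lemma block_index[simp]:
  "a < d \<Longrightarrow> b < d \<Longrightarrow> block d n X p q $$ (a, b) = X $$ (a * n + p, b * n + q)"
  unfolding block_def by simp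

lemma on_first_carrier[simp]: "on_first d d' n N X \<in> carrier_mat (d' * n) (d' * n)"
  unfolding on_first_def by simp

lemma on_first_index:
  assumes "a < d'" "b < d'" "p < n" "q < n"
  shows "on_first d d' n N X $$ (a * n + p, b * n + q) = N (block d n X p q) $$ (a, b)"
  using assms by (simp add: on_first_def block_def pair_index_less)

lemma tensor_carrier[simp]:
  "A \<in> carrier_mat d d \<Longrightarrow> B \<in> carrier_mat n n \<Longrightarrow> tensor A B \<in> carrier_mat (d * n) (d * n)"
  unfolding tensor_def by auto

lemma tensor_index:
  assumes "A \<in> carrier_mat d d" "B \<in> carrier_mat n n" "a < d" "b < d" "p < n" "q < n"
  shows "tensor A B $$ (a * n + p, b * n + q) = A $$ (a, b) * B $$ (p, q)"
  using assms by (simp add: tensor_def pair_index_less)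

text \<open>Splitting \<open>A\<close> into rank-one terms \<open>r k\<close> writes the form at
  \<open>v\<close> as a sum of forms of \<open>B\<close>, at the vectors \<open>w k\<close> obtained
  by contracting the first index of \<open>v\<close> with the conjugate of
  \<open>r k\<close>.\<close>

lemma psd_tensor:
  assumes A: "psd d A" and B: "psd n B"
  shows "psd (d * n) (tensor A B)"
proof (rule psdI)
  note cA = psdD(1)[OF A] and cB = psdD(1)[OF B]
  show c: "tensor A B \<in> carrier_mat (d * n) (d * n)" using cA cB by simp
  fix v :: "complex vec" assume v: "v \<in> carrier_vec (d * n)"
  obtain r where r: "\<And>k. r k \<in> carrier_vec d"
    "\<And>i j. i < d \<Longrightarrow> j < d \<Longrightarrow> A $$ (i, j) = (\<Sum>k<d. r k $ i * cnj (r k $ j))"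
    by (rule psd_rank_one_sum[OF A]) blast
  define w where "w k = vec n (\<lambda>q. \<Sum>b<d. cnj (r k $ b) * v $ (b * n + q))" for k
  have w: "w k \<in> carrier_vec n" for k by (simp add: w_def)
  have "sesq (tensor A B) v v = (\<Sum>p<n. \<Sum>q<n. \<Sum>k<d. B $$ (p, q) * w k $ q * cnj (w k $ p))"
    unfolding sesq_pairs[OF c v v]
  proof (rule sum.cong[OF refl], rule sum.cong[OF refl])
    fix p q assume "p \<in> {..<n}" "q \<in> {..<n}"
    then have pq: "p < n" "q < n" by auto
    have "(\<Sum>a<d. \<Sum>b<d. tensor A B $$ (a * n + p, b * n + q) * v $ (b * n + q) * cnj (v $ (a * n + p))) =
      (\<Sum>a<d. \<Sum>b<d. \<Sum>k<d. B $$ (p, q) * ((cnj (r k $ b) * v $ (b * n + q)) * cnj (cnj (r k $ a) * v $ (a * n + p))))"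
    proof (intro sum.cong refl)
      fix a b assume "a \<in> {..<d}" "b \<in> {..<d}"
      then have "tensor A B $$ (a * n + p, b * n + q) = (\<Sum>k<d. r k $ a * cnj (r k $ b)) * B $$ (p, q)"
        using pq by (simp add: tensor_index[OF cA cB] r(2))
      then show "tensor A B $$ (a * n + p, b * n + q) * v $ (b * n + q) * cnj (v $ (a * n + p)) =
        (\<Sum>k<d. B $$ (p, q) * ((cnj (r k $ b) * v $ (b * n + q)) * cnj (cnj (r k $ a) * v $ (a * n + p))))"
        by (simp add: sum_distrib_left sum_distrib_right mult_ac)
    qed
    also have "\<dots> = (\<Sum>a<d. \<Sum>k<d. \<Sum>b<d. B $$ (p, q) * ((cnj (r k $ b) * v $ (b * n + q)) * cnj (cnj (r k $ a) * v $ (a * n + p))))"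
      by (intro sum.cong refl sum.swap)
    also have "\<dots> = (\<Sum>k<d. \<Sum>a<d. \<Sum>b<d. B $$ (p, q) * ((cnj (r k $ b) * v $ (b * n + q)) * cnj (cnj (r k $ a) * v $ (a * n + p))))"
      by (rule sum.swap)
    also have "\<dots> = (\<Sum>k<d. B $$ (p, q) * w k $ q * cnj (w k $ p))"
    proof (intro sum.cong refl)
      fix k
      let ?x = "\<lambda>q b. cnj (r k $ b) * v $ (b * n + q)"
      have "(\<Sum>a<d. \<Sum>b<d. B $$ (p, q) * (?x q b * cnj (?x p a))) =
        (\<Sum>a<d. B $$ (p, q) * ((\<Sum>b<d. ?x q b) * cnj (?x p a)))"
        by (simp only: sum_distrib_left sum_distrib_right)
      also have "\<dots> = B $$ (p, q) * ((\<Sum>b<d. ?x q b) * cnj (\<Sum>a<d. ?x p a))"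
        by (simp only: sum_distrib_left cnj_sum)
      finally show "(\<Sum>a<d. \<Sum>b<d. B $$ (p, q) * (?x q b * cnj (?x p a))) = B $$ (p, q) * w k $ q * cnj (w k $ p)"
        using pq by (simp only: w_def index_vec mult.assoc)
    qed
    finally show "(\<Sum>a<d. \<Sum>b<d. tensor A B $$ (a * n + p, b * n + q) * v $ (b * n + q) * cnj (v $ (a * n + p))) =
      (\<Sum>k<d. B $$ (p, q) * w k $ q * cnj (w k $ p))" .
  qed
  also have "\<dots> = (\<Sum>p<n. \<Sum>k<d. \<Sum>q<n. B $$ (p, q) * w k $ q * cnj (w k $ p))"
    by (intro sum.cong refl sum.swap)
  also have "\<dots> = (\<Sum>k<d. \<Sum>p<n. \<Sum>q<n. B $$ (p, q) * w k $ q * cnj (w k $ p))"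
    by (rule sum.swap)
  also have "\<dots> = (\<Sum>k<d. sesq B (w k) (w k))"
    by (simp add: sesq_sum[OF cB w w])
  also have "0 \<le> \<dots>"
    using psdD(2)[OF B w] by (intro sum_nonneg)
  finally show "0 \<le> sesq (tensor A B) v v" .
qed

text \<open>This matrix is the partial trace of (F \<otimes> 1) X over the first system: the
  unnormalised state of the second system given an outcome with effect \<open>F\<close>. For a
  rank-one term \<open>f k\<close> of \<open>F\<close>, its form at \<open>w\<close> is that of
  \<open>X\<close> at the product vector of \<open>f k\<close> and \<open>w\<close>.\<close>

lemma psd_mtrace_mult_block:
  assumes X: "psd (d * n) X" and F: "psd d F"
  shows "psd n (mat n n (\<lambda>(p, q). mtrace (F * block d n X p q)))"
proof -
  note cX = psdD(1)[OF X] and cF = psdD(1)[OF F]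
  obtain f where f: "\<And>k. f k \<in> carrier_vec d"
    "\<And>i j. i < d \<Longrightarrow> j < d \<Longrightarrow> F $$ (i, j) = (\<Sum>k<d. f k $ i * cnj (f k $ j))"
    by (rule psd_rank_one_sum[OF F]) blast
  define Y where "Y k = mat n n (\<lambda>(p, q). sesq (block d n X p q) (f k) (f k))" for k
  have "psd n (Y k)" for k
  proof (rule psdI)
    show cY: "Y k \<in> carrier_mat n n" by (simp add: Y_def)
    fix w :: "complex vec" assume w: "w \<in> carrier_vec n"
    define u where "u = vec (d * n) (\<lambda>i. f k $ (i div n) * w $ (i mod n))"
    have u: "u \<in> carrier_vec (d * n)" by (simp add: u_def)
    have ui: "u $ (a * n + p) = f k $ a * w $ p" if "a < d" "p < n" for a p
      using that by (simp add: u_def pair_index_less)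
    have "sesq (Y k) w w = sesq X u u"
      unfolding sesq_sum[OF cY w w] sesq_pairs[OF cX u u]
      by (intro sum.cong refl)
        (simp add: Y_def ui sesq_sum[OF block_carrier f(1) f(1)] sum_distrib_left sum_distrib_right mult_ac)
    then show "0 \<le> sesq (Y k) w w" using psdD(2)[OF X u] by simp
  qed
  then have "psd n (mat n n (\<lambda>x. \<Sum>k<d. Y k $$ x))"
    by (rule psd_mat_sum)
  also have "mat n n (\<lambda>x. \<Sum>k<d. Y k $$ x) = mat n n (\<lambda>(p, q). mtrace (F * block d n X p q))"
  proof (intro eq_matI)
    fix p q assume "p < dim_row (mat n n (\<lambda>(p, q). mtrace (F * block d n X p q)))"
      "q < dim_col (mat n n (\<lambda>(p, q). mtrace (F * block d n X p q)))"
    then have pq: "p < n" "q < n" by auto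
    have "mtrace (F * block d n X p q) = mtrace (block d n X p q * F)"
      unfolding mtrace_mult[OF cF block_carrier] mtrace_mult[OF block_carrier cF]
      by (subst sum.swap) (simp add: mult.commute)
    also have "\<dots> = (\<Sum>k<d. sesq (block d n X p q) (f k) (f k))"
      by (rule mtrace_mult_rank_one_sum[OF block_carrier cF]) (use f in auto)
    finally show "mat n n (\<lambda>x. \<Sum>k<d. Y k $$ x) $$ (p, q) =
        mat n n (\<lambda>(p, q). mtrace (F * block d n X p q)) $$ (p, q)"
      using pq by (simp add: Y_def)
  qed auto
  finally show ?thesis .
qed

text \<open>An entanglement-breaking map with effects \<open>F i\<close> and prepared states
  \<open>R i\<close>. Encoder and decoder both have this form, so one proof of complete positivity
  covers both.\<close>

definition measure_prepare ::
  "nat \<Rightarrow> nat \<Rightarrow> (nat \<Rightarrow> complex mat) \<Rightarrow> (nat \<Rightarrow> complex mat) \<Rightarrow> complex mat \<Rightarrow> complex mat" where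
  "measure_prepare d k F R X = mat d d (\<lambda>x. \<Sum>i<k. mtrace (F i * X) * R i $$ x)"

text \<open>Complete positivity holds because the extended map yields a sum of product operators:
  \<open>R i\<close> tensored with the second system conditioned on outcome i. Completeness of the
  effects and unit trace of the \<open>R i\<close> give trace preservation.\<close>

lemma measure_prepare_channel:
  assumes F: "\<And>i. i < k \<Longrightarrow> psd d (F i)"
    and F1: "\<And>a b. a < d \<Longrightarrow> b < d \<Longrightarrow> (\<Sum>i<k. F i $$ (a, b)) = 1\<^sub>m d $$ (a, b)"
    and R: "\<And>i. i < k \<Longrightarrow> density d' (R i)"
  shows "quantum_channel d d' (measure_prepare d' k F R)"
proof -
  let ?E = "measure_prepare d' k F R"
  note cF = psdD(1)[OF F]
  have pR: "psd d' (R i)" and tR: "mtrace (R i) = 1" if "i < k" for i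
    using R[OF that] unfolding density_def by auto
  note cR = psdD(1)[OF pR]
  have tR': "(\<Sum>a<d'. R i $$ (a, a)) = 1" if "i < k" for i
    using tR[OF that] cR[OF that] unfolding mtrace_def by simp
  have "?E (X + Y) = ?E X + ?E Y" if "X \<in> carrier_mat d d" "Y \<in> carrier_mat d d" for X Y
    using that cF
    by (intro eq_matI)
      (auto simp: measure_prepare_def mtrace_mult[of _ d] distrib_left distrib_right sum.distrib)
  moreover have "?E (c \<cdot>\<^sub>m X) = c \<cdot>\<^sub>m ?E X" if "X \<in> carrier_mat d d" for c X
    using that cF
    by (intro eq_matI)
      (auto simp: measure_prepare_def mtrace_mult[of _ d] sum_distrib_left sum_distrib_right mult_ac
        intro!: sum.cong)
  moreover have "mtrace (?E X) = mtrace X" if X: "X \<in> carrier_mat d d" for X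
  proof -
    have "mtrace (?E X) = (\<Sum>a<d'. \<Sum>i<k. mtrace (F i * X) * R i $$ (a, a))"
      by (simp add: measure_prepare_def mtrace_def)
    also have "\<dots> = (\<Sum>i<k. mtrace (F i * X) * (\<Sum>a<d'. R i $$ (a, a)))"
      by (subst sum.swap) (simp add: sum_distrib_left)
    also have "\<dots> = (\<Sum>i<k. \<Sum>a<d. \<Sum>b<d. F i $$ (a, b) * X $$ (b, a))"
      using tR' X cF by (intro sum.cong refl) (simp add: mtrace_mult[of _ d])
    also have "\<dots> = (\<Sum>a<d. \<Sum>i<k. \<Sum>b<d. F i $$ (a, b) * X $$ (b, a))"
      by (rule sum.swap)
    also have "\<dots> = (\<Sum>a<d. \<Sum>b<d. \<Sum>i<k. F i $$ (a, b) * X $$ (b, a))"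
      by (intro sum.cong refl sum.swap)
    also have "\<dots> = (\<Sum>a<d. \<Sum>b<d. if b = a then X $$ (b, a) else 0)"
      using F1 by (intro sum.cong refl) (simp flip: sum_distrib_right)
    also have "\<dots> = mtrace X"
      using X by (simp add: mtrace_def)
    finally show ?thesis .
  qed
  moreover have "psd (d' * n) (on_first d d' n ?E X)" if X: "psd (d * n) X" for n X
  proof -
    let ?Y = "\<lambda>i. mat n n (\<lambda>(p, q). mtrace (F i * block d n X p q))"
    have "psd (d' * n) (mat (d' * n) (d' * n) (\<lambda>x. \<Sum>i<k. tensor (R i) (?Y i) $$ x))"
      using psd_tensor[OF pR psd_mtrace_mult_block[OF X F]] by (intro psd_mat_sum) auto
    also have "mat (d' * n) (d' * n) (\<lambda>x. \<Sum>i<k. tensor (R i) (?Y i) $$ x) = on_first d d' n ?E X"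
      by (rule eq_mat_pairs)
        (auto simp: pair_index_less on_first_index measure_prepare_def tensor_index[OF cR] intro!: sum.cong)
    finally show ?thesis .
  qed
  moreover have "?E X \<in> carrier_mat d' d'" for X
    by (simp add: measure_prepare_def)
  ultimately show ?thesis
    unfolding quantum_channel_def by blast
qed

section \<open>The measurement bound for density operators\<close>

lemma mtrace_mult_smult:
  assumes "A \<in> carrier_mat d d" "B \<in> carrier_mat d d"
  shows "mtrace (A * (c \<cdot>\<^sub>m B)) = c * mtrace (A * B)"
  using assms by (simp add: mtrace_mult[of _ d] sum_distrib_left mult_ac)

lemma mtrace_mult_sum:
  assumes "A \<in> carrier_mat d d" "\<And>x. x \<in> J \<Longrightarrow> B x \<in> carrier_mat d d"
  shows "mtrace (A * mat d d (\<lambda>i. \<Sum>x\<in>J. c x * B x $$ i)) = (\<Sum>x\<in>J. c x * mtrace (A * B x))"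
proof -
  have "mtrace (A * mat d d (\<lambda>i. \<Sum>x\<in>J. c x * B x $$ i)) =
      (\<Sum>a<d. \<Sum>b<d. \<Sum>x\<in>J. c x * (A $$ (a, b) * B x $$ (b, a)))"
    using assms(1) by (simp add: mtrace_mult[of _ d] sum_distrib_left mult_ac)
  also have "\<dots> = (\<Sum>a<d. \<Sum>x\<in>J. \<Sum>b<d. c x * (A $$ (a, b) * B x $$ (b, a)))"
    by (intro sum.cong refl sum.swap)
  also have "\<dots> = (\<Sum>x\<in>J. \<Sum>a<d. \<Sum>b<d. c x * (A $$ (a, b) * B x $$ (b, a)))"
    by (rule sum.swap)
  also have "\<dots> = (\<Sum>x\<in>J. c x * mtrace (A * B x))"
    using assms by (intro sum.cong refl) (simp add: mtrace_mult[of _ d] sum_distrib_left)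
  finally show ?thesis .
qed

text \<open>The bound at single vectors is summed over the rank-one terms \<open>s k\<close> of the
  state; unit trace makes their squared norms add up to 1. The measurement itself does not depend on
  the state.\<close>

lemma pretty_good_measurement_trace:
  assumes "finite I" "i0 \<in> I" and F: "\<And>i. i \<in> I \<Longrightarrow> psd d (F i)"
    and F1: "\<And>i. i \<in> I \<Longrightarrow> psd d (1\<^sub>m d - F i)"
  obtains L where "\<And>i. i \<in> I \<Longrightarrow> psd d (L i)"
    "\<And>a b. a < d \<Longrightarrow> b < d \<Longrightarrow> (\<Sum>i\<in>I. L i $$ (a, b)) = 1\<^sub>m d $$ (a, b)"
    "\<And>i \<omega>. i \<in> I \<Longrightarrow> density d \<omega> \<Longrightarrow>
      1 - 2 * (1 - Re (mtrace (F i * \<omega>))) - 4 * (\<Sum>j\<in>I - {i}. Re (mtrace (F j * \<omega>)))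
      \<le> Re (mtrace (L i * \<omega>))"
proof -
  obtain L where L: "\<And>i. i \<in> I \<Longrightarrow> psd d (L i)"
    "\<And>a b. a < d \<Longrightarrow> b < d \<Longrightarrow> (\<Sum>i\<in>I. L i $$ (a, b)) = 1\<^sub>m d $$ (a, b)"
    and bound: "\<And>i v. i \<in> I \<Longrightarrow> v \<in> carrier_vec d \<Longrightarrow>
      Re (v \<bullet>c v) - 2 * (Re (v \<bullet>c v) - Re (sesq (F i) v v)) - 4 * (\<Sum>j\<in>I - {i}. Re (sesq (F j) v v))
      \<le> Re (sesq (L i) v v)"
    by (rule pretty_good_measurement[of I i0 d F, OF assms]) (assumption | rule that)+
  have "1 - 2 * (1 - Re (mtrace (F i * \<omega>))) - 4 * (\<Sum>j\<in>I - {i}. Re (mtrace (F j * \<omega>)))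
      \<le> Re (mtrace (L i * \<omega>))" if i: "i \<in> I" and \<omega>: "density d \<omega>" for i \<omega>
  proof -
    have p: "psd d \<omega>" and t: "mtrace \<omega> = 1" using \<omega> by (auto simp: density_def)
    note c = psdD(1)[OF p]
    obtain s where s: "\<And>k. s k \<in> carrier_vec d"
      "\<And>i j. i < d \<Longrightarrow> j < d \<Longrightarrow> \<omega> $$ (i, j) = (\<Sum>k<d. s k $ i * cnj (s k $ j))"
      by (rule psd_rank_one_sum[OF p]) blast
    have tr: "mtrace (X * \<omega>) = (\<Sum>k<d. sesq X (s k) (s k))" if "X \<in> carrier_mat d d" for X
      by (rule mtrace_mult_rank_one_sum[OF that c]) (use s in auto)
    have one: "(\<Sum>k<d. Re (s k \<bullet>c s k)) = 1"
      using tr[of "1\<^sub>m d"] t c s(1) by (simp add: sesq_one flip: Re_sum)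
    have "(\<Sum>k<d. Re (s k \<bullet>c s k) - 2 * (Re (s k \<bullet>c s k) - Re (sesq (F i) (s k) (s k)))
        - 4 * (\<Sum>j\<in>I - {i}. Re (sesq (F j) (s k) (s k)))) \<le> (\<Sum>k<d. Re (sesq (L i) (s k) (s k)))"
      by (intro sum_mono bound i s)
    also have "\<dots> = Re (mtrace (L i * \<omega>))"
      using tr[OF psdD(1)[OF L(1)[OF i]]] by simp
    also have "(\<Sum>k<d. Re (s k \<bullet>c s k) - 2 * (Re (s k \<bullet>c s k) - Re (sesq (F i) (s k) (s k)))
        - 4 * (\<Sum>j\<in>I - {i}. Re (sesq (F j) (s k) (s k)))) =
      1 - 2 * (1 - (\<Sum>k<d. Re (sesq (F i) (s k) (s k)))) - 4 * (\<Sum>k<d. \<Sum>j\<in>I - {i}. Re (sesq (F j) (s k) (s k)))"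
      unfolding sum_subtractf sum_distrib_left[symmetric] one ..
    also have "(\<Sum>k<d. \<Sum>j\<in>I - {i}. Re (sesq (F j) (s k) (s k))) = (\<Sum>j\<in>I - {i}. Re (mtrace (F j * \<omega>)))"
      using tr psdD(1)[OF F] by (subst sum.swap) (auto intro!: sum.cong)
    also have "(\<Sum>k<d. Re (sesq (F i) (s k) (s k))) = Re (mtrace (F i * \<omega>))"
      using tr[OF psdD(1)[OF F[OF i]]] by simp
    finally show ?thesis .
  qed
  with L show thesis using that by blast
qed

section \<open>Channels on states and on linear combinations\<close>

lemma channel_carrier:
  "quantum_channel d d' N \<Longrightarrow> X \<in> carrier_mat d d \<Longrightarrow> N X \<in> carrier_mat d' d'"
  unfolding quantum_channel_def by blast

lemma channel_smult:
  "quantum_channel d d' N \<Longrightarrow> X \<in> carrier_mat d d \<Longrightarrow> N (c \<cdot>\<^sub>m X) = c \<cdot>\<^sub>m N X"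
  unfolding quantum_channel_def by blast

lemma channel_mtrace:
  "quantum_channel d d' N \<Longrightarrow> X \<in> carrier_mat d d \<Longrightarrow> mtrace (N X) = mtrace X"
  unfolding quantum_channel_def by blast

lemma channel_zero:
  assumes "quantum_channel d d' N"
  shows "N (0\<^sub>m d d) = 0\<^sub>m d' d'"
proof -
  have "0\<^sub>m d d = 0 \<cdot>\<^sub>m (0\<^sub>m d d :: complex mat)" by (intro eq_matI) auto
  then have "N (0\<^sub>m d d) = 0 \<cdot>\<^sub>m N (0\<^sub>m d d)"
    using channel_smult[OF assms, of "0\<^sub>m d d" 0] by simp
  also have "\<dots> = 0\<^sub>m d' d'"
    using channel_carrier[OF assms, of "0\<^sub>m d d"] by (intro eq_matI) auto
  finally show ?thesis .
qed

lemma channel_sum: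
  fixes n :: nat
  assumes N: "quantum_channel d d' N" and "\<And>x. x < n \<Longrightarrow> \<rho> x \<in> carrier_mat d d"
  shows "N (mat d d (\<lambda>i. \<Sum>x<n. c x * \<rho> x $$ i)) = mat d' d' (\<lambda>i. \<Sum>x<n. c x * N (\<rho> x) $$ i)"
  using assms(2)
proof (induction n)
  case 0
  have "mat m m (\<lambda>i. 0) = (0\<^sub>m m m :: complex mat)" for m by (intro eq_matI) auto
  then show ?case using channel_zero[OF N] by simp
next
  case (Suc n)
  let ?M = "mat d d (\<lambda>i. \<Sum>x<n. c x * \<rho> x $$ i)"
  have r: "\<rho> n \<in> carrier_mat d d" using Suc.prems by simp
  have "mat d d (\<lambda>i. \<Sum>x<Suc n. c x * \<rho> x $$ i) = ?M + c n \<cdot>\<^sub>m \<rho> n"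
    using r by (intro eq_matI) auto
  also have "N \<dots> = N ?M + N (c n \<cdot>\<^sub>m \<rho> n)"
    using N r unfolding quantum_channel_def by simp
  also have "\<dots> = mat d' d' (\<lambda>i. \<Sum>x<n. c x * N (\<rho> x) $$ i) + c n \<cdot>\<^sub>m N (\<rho> n)"
    using Suc channel_smult[OF N r] by simp
  also have "\<dots> = mat d' d' (\<lambda>i. \<Sum>x<Suc n. c x * N (\<rho> x) $$ i)"
    using channel_carrier[OF N r] by (intro eq_matI) auto
  finally show ?case .
qed

text \<open>Plain positivity is complete positivity with a one-dimensional second system.\<close>

lemma channel_density:
  assumes N: "quantum_channel d d' N" and "density d \<rho>"
  shows "density d' (N \<rho>)"
proof -
  have p: "psd d \<rho>" and t: "mtrace \<rho> = 1" using assms by (auto simp: density_def)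
  note c = psdD(1)[OF p]
  have "psd (d' * 1) (on_first d d' 1 N \<rho>)"
    using N p unfolding quantum_channel_def by (metis mult.right_neutral)
  moreover have "mat d d (\<lambda>(k, l). \<rho> $$ (k * 1 + 0, l * 1 + 0)) = \<rho>"
    using c by (intro eq_matI) auto
  then have "on_first d d' 1 N \<rho> = N \<rho>"
    using channel_carrier[OF N c] by (intro eq_matI) (auto simp: on_first_def)
  ultimately show ?thesis
    using channel_mtrace[OF N c] t by (simp add: density_def)
qed

text \<open>A quantum-classical operator with the classical register second. Its blocks may be
  unnormalised, so probabilities are carried by the blocks themselves.\<close>

definition block_diag :: "nat \<Rightarrow> nat \<Rightarrow> (nat \<Rightarrow> complex mat) \<Rightarrow> complex mat" where
  "block_diag d n B = mat (d * n) (d * n)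
     (\<lambda>(i, j). if i mod n = j mod n then B (i mod n) $$ (i div n, j div n) else 0)"

lemma block_diag_carrier[simp]: "block_diag d n B \<in> carrier_mat (d * n) (d * n)"
  unfolding block_diag_def by simp

lemma block_diag_index:
  assumes "a < d" "b < d" "p < n" "q < n"
  shows "block_diag d n B $$ (a * n + p, b * n + q) = (if p = q then B p $$ (a, b) else 0)"
  using assms by (simp add: block_diag_def pair_index_less)

lemma block_block_diag:
  assumes "B p \<in> carrier_mat d d" "p < n" "q < n"
  shows "block d n (block_diag d n B) p q = (if p = q then B p else 0\<^sub>m d d)"
  using assms by (intro eq_matI) (auto simp: block_diag_index)

lemma on_first_block_diag:
  assumes N: "quantum_channel d d' N" and "\<And>p. p < n \<Longrightarrow> B p \<in> carrier_mat d d"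
  shows "on_first d d' n N (block_diag d n B) = block_diag d' n (\<lambda>p. N (B p))"
  using assms
  by (intro eq_mat_pairs[of _ d' n])
    (auto simp: on_first_index block_diag_index block_block_diag channel_zero[OF N])

lemma mtrace_mult_block_diag:
  assumes T: "T \<in> carrier_mat (d * n) (d * n)" and B: "\<And>p. p < n \<Longrightarrow> B p \<in> carrier_mat d d"
  shows "mtrace (T * block_diag d n B) = (\<Sum>p<n. mtrace (block d n T p p * B p))"
proof -
  have "mtrace (T * block_diag d n B) = (\<Sum>p<n. \<Sum>q<n. \<Sum>a<d. \<Sum>b<d.
      T $$ (a * n + p, b * n + q) * block_diag d n B $$ (b * n + q, a * n + p))"
    unfolding mtrace_mult[OF T block_diag_carrier] sum_pair_index by (rule sum_swap_pairs)
  also have "\<dots> = (\<Sum>p<n. \<Sum>q<n. if q = p then \<Sum>a<d. \<Sum>b<d. T $$ (a * n + p, b * n + p) * B p $$ (b, a) else 0)"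
    by (intro sum.cong[OF refl]) (auto simp: block_diag_index)
  also have "\<dots> = (\<Sum>p<n. mtrace (block d n T p p * B p))"
    using B by (simp add: mtrace_mult[of _ d])
  finally show ?thesis .
qed

lemma block_one: "p < n \<Longrightarrow> block d n (1\<^sub>m (d * n)) p p = 1\<^sub>m d"
  by (intro eq_matI) (auto simp: pair_index_less)

lemma mtrace_block_diag:
  assumes "\<And>p. p < n \<Longrightarrow> B p \<in> carrier_mat d d"
  shows "mtrace (block_diag d n B) = (\<Sum>p<n. mtrace (B p))"
  using mtrace_mult_block_diag[of "1\<^sub>m (d * n)" d n B] assms
  by (simp add: block_one left_mult_one_mat[of _ "d * n" "d * n"] left_mult_one_mat[of _ d d])

text \<open>A diagonal block is a compression: its form at \<open>v\<close> is that of
  \<open>T\<close> at \<open>v\<close> tensored with basis vector \<open>p\<close>.\<close>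

lemma psd_block:
  assumes T: "psd (d * n) T" and p: "p < n"
  shows "psd d (block d n T p p)"
proof (rule psdI)
  note c = psdD(1)[OF T]
  fix v :: "complex vec" assume v: "v \<in> carrier_vec d"
  define u where "u = vec (d * n) (\<lambda>i. if i mod n = p then v $ (i div n) else 0)"
  have u: "u \<in> carrier_vec (d * n)" by (simp add: u_def)
  have ui: "u $ (a * n + q) = (if q = p then v $ a else 0)" if "a < d" "q < n" for a q
    using that by (simp add: u_def pair_index_less)
  have "sesq T u u = (\<Sum>q<n. \<Sum>r<n. if r = p then if q = p then
      \<Sum>a<d. \<Sum>b<d. T $$ (a * n + p, b * n + p) * v $ b * cnj (v $ a) else 0 else 0)"
    unfolding sesq_pairs[OF c u u] by (intro sum.cong[OF refl]) (auto simp: ui)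
  also have "\<dots> = sesq (block d n T p p) v v"
    using p by (simp add: sesq_sum[OF block_carrier v v])
  finally show "0 \<le> sesq (block d n T p p) v v"
    using psdD(2)[OF T u] by simp
qed simp

lemma psd_block_diag:
  assumes B: "\<And>p. p < n \<Longrightarrow> psd d (B p)"
  shows "psd (d * n) (block_diag d n B)"
proof (rule psdI)
  fix v :: "complex vec" assume v: "v \<in> carrier_vec (d * n)"
  define u where "u p = vec d (\<lambda>a. v $ (a * n + p))" for p
  have u: "u p \<in> carrier_vec d" for p by (simp add: u_def)
  have "sesq (block_diag d n B) v v = (\<Sum>p<n. \<Sum>q<n. if q = p then
      \<Sum>a<d. \<Sum>b<d. B p $$ (a, b) * v $ (b * n + p) * cnj (v $ (a * n + p)) else 0)"
    unfolding sesq_pairs[OF block_diag_carrier v v]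
    by (intro sum.cong[OF refl]) (auto simp: block_diag_index)
  also have "\<dots> = (\<Sum>p<n. sesq (B p) (u p) (u p))"
    by (intro sum.cong refl) (simp add: sesq_sum[OF psdD(1)[OF B] u u], simp add: u_def)
  also have "0 \<le> \<dots>"
    using psdD(2)[OF B u] by (intro sum_nonneg) auto
  finally show "0 \<le> sesq (block_diag d n B) v v" .
qed simp

lemma tensor_mat_diag:
  assumes "A \<in> carrier_mat d d"
  shows "tensor A (mat_diag n f) = block_diag d n (\<lambda>x. f x \<cdot>\<^sub>m A)"
  using assms
  by (intro eq_mat_pairs[of _ d n])
    (auto simp: tensor_index block_diag_index mat_diag_def)

text \<open>Regroups c * (d * n) as (c * d) * n, leaving the classical register last. The coding
  proof uses it to attach the message register in front of E_A while E_B remains the block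
  index.\<close>

lemma tensor_block_diag:
  assumes A: "A \<in> carrier_mat c c" and B: "\<And>p. p < n \<Longrightarrow> B p \<in> carrier_mat d d"
  shows "tensor A (block_diag d n B) = block_diag (c * d) n (\<lambda>p. tensor A (B p))"
proof (rule eq_mat_pairs[of _ "c * d" n])
  fix i j p q assume ij: "i < c * d" "j < c * d" and pq: "p < n" "q < n"
  then have d: "d > 0" by (cases d) auto
  have dm: "(i * n + p) div (d * n) = i div d" "(i * n + p) mod (d * n) = (i mod d) * n + p"
    if "p < n" for i p
    using that by (simp_all add: mult.commute[of d n] div_mult2_eq mod_mult2_eq)
  have "i * n + p < c * (d * n)" "j * n + q < c * (d * n)"
    using ij pq pair_index_less[of i "c * d" p n] pair_index_less[of j "c * d" q n]
    by (auto simp: mult.assoc)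
  then show "tensor A (block_diag d n B) $$ (i * n + p, j * n + q) =
      block_diag (c * d) n (\<lambda>p. tensor A (B p)) $$ (i * n + p, j * n + q)"
    using A carrier_matD[OF B] ij pq d carrier_matD[OF block_diag_carrier[of d n B]]
    by (simp add: block_diag_index tensor_def[of A] dm)
qed (use A block_diag_carrier[of "c * d" n "\<lambda>p. tensor A (B p)"] in \<open>simp_all add: mult.assoc\<close>)

section \<open>Random codebooks and position-based decoding\<close>

text \<open>The law of one codeword: the sum over codebooks factorises over messages, and every
  factor except that of \<open>m\<close> is 1.\<close>

lemma sum_PiE_prod_one:
  fixes p g :: "'b \<Rightarrow> real"
  assumes "finite M" "finite X" "(\<Sum>x\<in>X. p x) = 1" "m \<in> M"
  shows "(\<Sum>f\<in>PiE M (\<lambda>_. X). (\<Prod>i\<in>M. p (f i)) * g (f m)) = (\<Sum>x\<in>X. p x * g x)"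
proof -
  let ?h = "\<lambda>i x. if i = m then g x else 1"
  have "(\<Sum>f\<in>PiE M (\<lambda>_. X). (\<Prod>i\<in>M. p (f i)) * g (f m)) =
      (\<Sum>f\<in>PiE M (\<lambda>_. X). \<Prod>i\<in>M. p (f i) * ?h i (f i))"
    using assms(1,4) by (simp add: prod.distrib prod.delta)
  also have "\<dots> = (\<Prod>i\<in>M. \<Sum>x\<in>X. p x * ?h i x)"
    using assms(1,2) by (simp add: prod_sum_PiE)
  also have "\<dots> = (\<Prod>i\<in>M. if i = m then \<Sum>x\<in>X. p x * g x else 1)"
    using assms(3) by (intro prod.cong) auto
  also have "\<dots> = (\<Sum>x\<in>X. p x * g x)"
    using assms(1,4) by simp
  finally show ?thesis .
qed

lemma sum_PiE_prod_two:
  fixes p :: "'b \<Rightarrow> real"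
  assumes "finite M" "finite X" "(\<Sum>x\<in>X. p x) = 1" "m \<in> M" "m' \<in> M" "m \<noteq> m'"
  shows "(\<Sum>f\<in>PiE M (\<lambda>_. X). (\<Prod>i\<in>M. p (f i)) * h (f m) (f m')) =
    (\<Sum>x\<in>X. \<Sum>y\<in>X. p x * p y * h x y)"
proof -
  have prod_two: "(\<Sum>f\<in>PiE M (\<lambda>_. X). (\<Prod>i\<in>M. p (f i)) * (u (f m) * w (f m'))) =
      (\<Sum>x\<in>X. p x * u x) * (\<Sum>x\<in>X. p x * w x)" for u w
  proof -
    let ?h = "\<lambda>i x. (if i = m then u x else 1) * (if i = m' then w x else 1)"
    have "(\<Sum>f\<in>PiE M (\<lambda>_. X). (\<Prod>i\<in>M. p (f i)) * (u (f m) * w (f m'))) =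
        (\<Sum>f\<in>PiE M (\<lambda>_. X). \<Prod>i\<in>M. p (f i) * ?h i (f i))"
      using assms(1,4,5) by (simp add: prod.distrib prod.delta)
    also have "\<dots> = (\<Prod>i\<in>M. \<Sum>x\<in>X. p x * ?h i x)"
      using assms(1,2) by (simp add: prod_sum_PiE)
    also have "\<dots> = (\<Prod>i\<in>M. (if i = m then \<Sum>x\<in>X. p x * u x else 1) * (if i = m' then \<Sum>x\<in>X. p x * w x else 1))"
      using assms(3,6) by (intro prod.cong) auto
    also have "\<dots> = (\<Sum>x\<in>X. p x * u x) * (\<Sum>x\<in>X. p x * w x)"
      using assms(1,4,5) by (simp add: prod.distrib)
    finally show ?thesis .
  qed
  \<comment> \<open>An arbitrary \<open>h\<close> is reduced to the product case by expanding it
    over the value x of the first codeword, as an indicator of \<open>f m = x\<close> times a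
    function of \<open>f m'\<close>.\<close>
  have "(\<Sum>f\<in>PiE M (\<lambda>_. X). (\<Prod>i\<in>M. p (f i)) * h (f m) (f m')) =
      (\<Sum>f\<in>PiE M (\<lambda>_. X). \<Sum>x\<in>X. (\<Prod>i\<in>M. p (f i)) * ((if f m = x then 1 else 0) * h x (f m')))"
  proof (rule sum.cong[OF refl])
    fix f assume "f \<in> PiE M (\<lambda>_. X)"
    then have "f m \<in> X" using assms(4) by auto
    have "(\<Sum>x\<in>X. (\<Prod>i\<in>M. p (f i)) * ((if f m = x then 1 else 0) * h x (f m'))) =
        (\<Sum>x\<in>X. if x = f m then (\<Prod>i\<in>M. p (f i)) * h x (f m') else 0)"
      by (intro sum.cong) auto
    then show "(\<Prod>i\<in>M. p (f i)) * h (f m) (f m') =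
        (\<Sum>x\<in>X. (\<Prod>i\<in>M. p (f i)) * ((if f m = x then 1 else 0) * h x (f m')))"
      using assms(2) \<open>f m \<in> X\<close> by simp
  qed
  also have "\<dots> = (\<Sum>x\<in>X. (\<Sum>z\<in>X. p z * (if z = x then 1 else 0)) * (\<Sum>y\<in>X. p y * h x y))"
  proof (subst sum.swap, rule sum.cong[OF refl])
    fix x
    show "(\<Sum>f\<in>PiE M (\<lambda>_. X). (\<Prod>i\<in>M. p (f i)) * ((if f m = x then 1 else 0) * h x (f m'))) =
        (\<Sum>z\<in>X. p z * (if z = x then 1 else 0)) * (\<Sum>y\<in>X. p y * h x y)"
      by (rule prod_two)
  qed
  also have "\<dots> = (\<Sum>x\<in>X. p x * (\<Sum>y\<in>X. p y * h x y))"
    using assms(2) by (intro sum.cong refl) (auto simp: if_distrib cong: if_cong)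
  also have "\<dots> = (\<Sum>x\<in>X. \<Sum>y\<in>X. p x * p y * h x y)"
    by (simp add: sum_distrib_left mult.assoc)
  finally show ?thesis .
qed

text \<open>A strict lower bound on the nested suprema is witnessed by one state and one test,
  whether or not the suprema are attained or finite. The last two conclusions concern a test at the
  transmitted symbol and a test at an independent symbol.\<close>

lemma cq_tests:
  assumes N: "quantum_channel dA dB N" and c: "ereal c < cq_hyp_test_info dA dB N \<epsilon>"
  obtains n :: nat and p \<rho> T where "\<And>x. x < n \<Longrightarrow> 0 \<le> p x" "(\<Sum>x<n. p x) = 1"
    "\<And>x. x < n \<Longrightarrow> density dA (\<rho> x)"
    "\<And>x. x < n \<Longrightarrow> psd dB (T x)" "\<And>x. x < n \<Longrightarrow> psd dB (1\<^sub>m dB - T x)"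
    "1 - \<epsilon> \<le> (\<Sum>x<n. p x * Re (mtrace (T x * N (\<rho> x))))"
    "(\<Sum>x<n. \<Sum>y<n. p x * p y * Re (mtrace (T y * N (\<rho> x)))) < 2 powr (- c)"
proof -
  obtain n \<psi> where cq: "cq_state dA n \<psi>" and h: "ereal c <
      hyp_test_div (dB * n) \<epsilon> (on_first dA dB n N \<psi>) (tensor (N (trace_snd dA n \<psi>)) (trace_fst dA n \<psi>))"
    using c unfolding cq_hyp_test_info_def less_Sup_iff by auto
  from cq obtain p \<rho> where p: "\<And>x. x < n \<Longrightarrow> 0 \<le> p x" "(\<Sum>x<n. p x) = 1"
    and \<rho>: "\<And>x. x < n \<Longrightarrow> density dA (\<rho> x)"
    and \<psi>: "\<psi> = mat (dA * n) (dA * n) (\<lambda>(i, j). if i mod n = j mod n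
           then complex_of_real (p (i mod n)) * \<rho> (i mod n) $$ (i div n, j div n) else 0)"
    unfolding cq_state_def by auto
  have c\<rho>: "\<rho> x \<in> carrier_mat dA dA" and t\<rho>: "mtrace (\<rho> x) = 1" if "x < n" for x
    using \<rho>[OF that] psdD(1) by (auto simp: density_def)
  note cN = channel_carrier[OF N c\<rho>]
  have n0: "0 < n" using p(2) by (cases n) auto
  have \<psi>bd: "\<psi> = block_diag dA n (\<lambda>x. complex_of_real (p x) \<cdot>\<^sub>m \<rho> x)"
    unfolding \<psi> using n0 c\<rho> carrier_matD[OF c\<rho>]
    by (intro eq_mat_pairs[of _ dA n]) (auto simp: block_diag_index pair_index_less)
  obtain T where T: "psd (dB * n) T" "psd (dB * n) (1\<^sub>m (dB * n) - T)"
    and T1: "Re (mtrace (T * on_first dA dB n N \<psi>)) \<ge> 1 - \<epsilon>"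
    and T2: "ereal c < log_recip (Re (mtrace (T * tensor (N (trace_snd dA n \<psi>)) (trace_fst dA n \<psi>))))"
    using h unfolding hyp_test_div_def less_SUP_iff by auto
  note cT = psdD(1)[OF T(1)]
  define B where "B x = block dB n T x x" for x
  have cB: "B x \<in> carrier_mat dB dB" for x by (simp add: B_def)
  have pB: "psd dB (B x)" if "x < n" for x
    unfolding B_def using psd_block[OF T(1) that] .
  have "psd dB (1\<^sub>m dB - B x)" if "x < n" for x
  proof -
    have "block dB n (1\<^sub>m (dB * n) - T) x x = 1\<^sub>m dB - B x"
      unfolding B_def using cT that by (intro eq_matI) (auto simp: pair_index_less)
    then show ?thesis using psd_block[OF T(2) that] by simp
  qed
  moreover have "1 - \<epsilon> \<le> (\<Sum>x<n. p x * Re (mtrace (B x * N (\<rho> x))))"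
  proof -
    have "on_first dA dB n N \<psi> = block_diag dB n (\<lambda>x. N (complex_of_real (p x) \<cdot>\<^sub>m \<rho> x))"
      unfolding \<psi>bd using c\<rho> by (intro on_first_block_diag[OF N]) simp
    then have "mtrace (T * on_first dA dB n N \<psi>) = (\<Sum>x<n. mtrace (B x * N (complex_of_real (p x) \<cdot>\<^sub>m \<rho> x)))"
      using mtrace_mult_block_diag[OF cT] channel_carrier[OF N] c\<rho> by (simp add: B_def)
    also have "\<dots> = (\<Sum>x<n. complex_of_real (p x) * mtrace (B x * N (\<rho> x)))"
      using cN c\<rho> cB by (intro sum.cong refl) (simp add: channel_smult[OF N] mtrace_mult_smult[of _ dB])
    finally show ?thesis using T1 by simp
  qed
  moreover have "(\<Sum>x<n. \<Sum>y<n. p x * p y * Re (mtrace (B y * N (\<rho> x)))) < 2 powr (- c)" (is "?\<tau> < _")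
  proof -
    let ?\<sigma> = "mat dA dA (\<lambda>i. \<Sum>x<n. complex_of_real (p x) * \<rho> x $$ i)"
    \<comment> \<open>The A marginal is the p-average of the states and the A' marginal is the law
      p. Linearity of the channel therefore turns the trace against their product into the double
      sum over independent symbols x and y.\<close>
    have snd: "trace_snd dA n \<psi> = ?\<sigma>"
      unfolding \<psi>bd trace_snd_def using carrier_matD[OF c\<rho>]
      by (intro eq_matI) (auto simp: block_diag_index)
    have tr1: "(\<Sum>i<dA. \<rho> x $$ (i, i)) = 1" if "x < n" for x
      using t\<rho>[OF that] c\<rho>[OF that] by (simp add: mtrace_def)
    have fst: "trace_fst dA n \<psi> = mat_diag n (\<lambda>x. complex_of_real (p x))"
      unfolding \<psi>bd trace_fst_def mat_diag_def using carrier_matD[OF c\<rho>] tr1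
      by (intro eq_matI) (auto simp: block_diag_index simp flip: sum_distrib_left)
    have N\<sigma>: "N ?\<sigma> = mat dB dB (\<lambda>i. \<Sum>x<n. complex_of_real (p x) * N (\<rho> x) $$ i)"
      using c\<rho> by (rule channel_sum[OF N])
    have cN\<sigma>: "N ?\<sigma> \<in> carrier_mat dB dB" unfolding N\<sigma> by simp
    have "mtrace (T * tensor (N (trace_snd dA n \<psi>)) (trace_fst dA n \<psi>)) =
        (\<Sum>y<n. complex_of_real (p y) * mtrace (B y * N ?\<sigma>))"
      unfolding snd fst tensor_mat_diag[OF cN\<sigma>] B_def
      using mtrace_mult_block_diag[OF cT, of "\<lambda>x. complex_of_real (p x) \<cdot>\<^sub>m N ?\<sigma>"] cN\<sigma>
      by (simp add: mtrace_mult_smult[of _ dB])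
    also have "\<dots> = (\<Sum>y<n. complex_of_real (p y) * (\<Sum>x<n. complex_of_real (p x) * mtrace (B y * N (\<rho> x))))"
      unfolding N\<sigma> using cN by (intro sum.cong refl arg_cong2[where f = "(*)"] mtrace_mult_sum[OF cB]) auto
    also have "Re \<dots> = ?\<tau>"
      by (subst sum.swap) (simp add: sum_distrib_left mult_ac)
    finally have "ereal c < log_recip ?\<tau>" using T2 by simp
    then show ?thesis
    proof (cases "?\<tau> > 0")
      case True
      with \<open>ereal c < log_recip ?\<tau>\<close> have "c < log 2 (1 / ?\<tau>)"
        by (simp add: log_recip_def)
      also have "\<dots> = - log 2 ?\<tau>" using True by (simp add: log_divide)
      finally have "log 2 ?\<tau> < - c" by simp
      then show ?thesis using True by (simp add: log_less_iff)
    next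
      \<comment> \<open>Here \<open>log_recip\<close> is infinite and gives no information, but a
        value that is at most 0 lies below every power of 2.\<close>
      case False
      then have "?\<tau> \<le> 0" by simp
      also have "0 < 2 powr (- c)" by simp
      finally show ?thesis .
    qed
  qed
  ultimately show thesis using that[of n p \<rho> B] p \<rho> pB by blast
qed

section \<open>Basis states and classical outcomes\<close>

lemma basis_state_carrier[simp]: "basis_state K m \<in> carrier_mat K K"
  unfolding basis_state_def by simp

lemma basis_state_eq_mat_diag: "basis_state K m = mat_diag K (\<lambda>i. if i = m then 1 else 0)"
  unfolding basis_state_def mat_diag_def by (intro eq_matI) auto

lemma mtrace_basis_state_mult:
  assumes "m < K" "X \<in> carrier_mat K K"
  shows "mtrace (basis_state K m * X) = X $$ (m, m)"
proof -
  have "mtrace (basis_state K m * X) = (\<Sum>i<K. \<Sum>j<K. if j = m then if i = m then X $$ (m, m) else 0 else 0)"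
    unfolding mtrace_mult[OF basis_state_carrier assms(2)]
    by (intro sum.cong refl) (auto simp: basis_state_def)
  then show ?thesis using assms(1) by simp
qed

lemma psd_basis_state: "psd K (basis_state K m)"
  unfolding basis_state_eq_mat_diag by (rule psd_mat_diag) (simp add: less_eq_complex_def)

lemma density_basis_state:
  assumes "m < K"
  shows "density K (basis_state K m)"
proof -
  have "mtrace (basis_state K m) = (\<Sum>i<K. if i = m then 1 else 0)"
    unfolding mtrace_def basis_state_def by (intro sum.cong) auto
  then show ?thesis using assms psd_basis_state by (simp add: density_def)
qed

lemma tensor_basis_state:
  assumes "m < K" "k < n"
  shows "tensor (basis_state K m) (c \<cdot>\<^sub>m basis_state n k) = c \<cdot>\<^sub>m basis_state (K * n) (m * n + k)"
proof (rule eq_mat_pairs[of _ K n])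
  fix a b p q assume ab: "a < K" "b < K" and pq: "p < n" "q < n"
  have *: "x * n + y = m * n + k \<longleftrightarrow> x = m \<and> y = k" if "y < n" for x y
  proof
    assume "x * n + y = m * n + k"
    then have "(x * n + y) div n = (m * n + k) div n" "(x * n + y) mod n = (m * n + k) mod n" by auto
    then show "x = m \<and> y = k" using that assms by simp
  qed simp
  show "tensor (basis_state K m) (c \<cdot>\<^sub>m basis_state n k) $$ (a * n + p, b * n + q) =
      (c \<cdot>\<^sub>m basis_state (K * n) (m * n + k)) $$ (a * n + p, b * n + q)"
    using ab pq pair_index_less[OF ab(1) pq(1)] pair_index_less[OF ab(2) pq(2)]
    by (subst tensor_index[of _ K _ n]) (auto simp: basis_state_def *)
qed (auto simp: basis_state_def)

lemma measure_prepare_diag_entry: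
  assumes "m < K"
  shows "measure_prepare K K F (basis_state K) X $$ (m, m) = mtrace (F m * X)"
proof -
  have "measure_prepare K K F (basis_state K) X $$ (m, m) =
      (\<Sum>i<K. mtrace (F i * X) * basis_state K i $$ (m, m))"
    using assms by (simp add: measure_prepare_def)
  also have "\<dots> = (\<Sum>i<K. if i = m then mtrace (F m * X) else 0)"
    using assms by (intro sum.cong refl) (auto simp: basis_state_def)
  finally show ?thesis using assms by simp
qed

lemma diagonal_measure_prepare: "diagonal_mat (measure_prepare K K F (basis_state K) X)"
  unfolding diagonal_mat_def measure_prepare_def by (auto simp: basis_state_def intro!: sum.neutral)

lemma measure_prepare_basis_state:
  assumes "j < d" "\<And>i. i < d \<Longrightarrow> R i \<in> carrier_mat d' d'"
  shows "measure_prepare d' d (basis_state d) R (basis_state d j) = R j"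
proof (rule eq_matI)
  fix a b assume "a < dim_row (R j)" "b < dim_col (R j)"
  then have ab: "a < d'" "b < d'" using assms(2)[OF assms(1)] by auto
  have "measure_prepare d' d (basis_state d) R (basis_state d j) $$ (a, b) =
      (\<Sum>i<d. basis_state d j $$ (i, i) * R i $$ (a, b))"
    using ab by (simp add: measure_prepare_def mtrace_basis_state_mult)
  also have "\<dots> = (\<Sum>i<d. if i = j then R j $$ (a, b) else 0)"
    by (intro sum.cong refl) (auto simp: basis_state_def)
  finally show "measure_prepare d' d (basis_state d) R (basis_state d j) $$ (a, b) = R j $$ (a, b)"
    using assms(1) by simp
qed (use assms in \<open>auto simp: measure_prepare_def\<close>)

text \<open>All maps from messages to symbols are numbered, so that a codebook can be stored as a
  basis index. Of the product law, the conclusion keeps the marginals for one message and for two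
  distinct ones: pairwise independence carries the error analysis.\<close>

lemma random_codebook:
  fixes p :: "nat \<Rightarrow> real" and n K :: nat
  assumes p: "\<And>x. x < n \<Longrightarrow> 0 \<le> p x" "(\<Sum>x<n. p x) = 1" and K: "0 < K"
  obtains l :: nat and P c where "\<And>k. k < l \<Longrightarrow> 0 \<le> P k" "(\<Sum>k<l. P k) = (1 :: real)"
    "\<And>k m. k < l \<Longrightarrow> m < K \<Longrightarrow> c k m < n"
    "\<And>g m. m < K \<Longrightarrow> (\<Sum>k<l. P k * g (c k m)) = (\<Sum>x<n. p x * g x)"
    "\<And>h m m'. m < K \<Longrightarrow> m' < K \<Longrightarrow> m \<noteq> m' \<Longrightarrow>
      (\<Sum>k<l. P k * h (c k m) (c k m')) = (\<Sum>x<n. \<Sum>y<n. p x * p y * h x y)"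
proof -
  define C where "C = PiE {..<K} (\<lambda>_. {..<n})"
  have "finite C" unfolding C_def by (intro finite_PiE) auto
  then obtain c where c: "bij_betw c {..<card C} C"
    using ex_bij_betw_nat_finite[of C] by (auto simp: atLeast0LessThan)
  define P where "P k = (\<Prod>i<K. p (c k i))" for k
  have cC: "c k \<in> C" if "k < card C" for k
    using bij_betwE[OF c] that by simp
  have cn: "c k m < n" if "k < card C" "m < K" for k m
    using cC[OF that(1)] that(2) unfolding C_def by auto
  have re: "(\<Sum>k<card C. P k * G (c k)) = (\<Sum>f\<in>C. (\<Prod>i<K. p (f i)) * G f)" for G
    unfolding P_def using sum.reindex_bij_betw[OF c, of "\<lambda>f. (\<Prod>i<K. p (f i)) * G f"] .
  have one: "(\<Sum>k<card C. P k * g (c k m)) = (\<Sum>x<n. p x * g x)" if "m < K" for g m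
    using re[of "\<lambda>f. g (f m)"] sum_PiE_prod_one[of "{..<K}" "{..<n}" p m g] that p(2)
    unfolding C_def by simp
  have two: "(\<Sum>k<card C. P k * h (c k m) (c k m')) = (\<Sum>x<n. \<Sum>y<n. p x * p y * h x y)"
    if "m < K" "m' < K" "m \<noteq> m'" for h m m'
    using re[of "\<lambda>f. h (f m) (f m')"] sum_PiE_prod_two[of "{..<K}" "{..<n}" p m m' h] that p(2)
    unfolding C_def by simp
  \<comment> \<open>Total mass is the expectation of the constant 1 at message 0, which exists since
    K > 0.\<close>
  have "(\<Sum>k<card C. P k) = 1"
    using one[OF K, of "\<lambda>_. 1"] p(2) by simp
  moreover have "0 \<le> P k" if "k < card C" for k
    unfolding P_def using p(1) cn[OF that] by (intro prod_nonneg) auto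
  ultimately show thesis using that[of "card C" P c] cn one two by blast
qed

text \<open>For each k the measurement bound holds pointwise, and averaging over the shared k
  replaces its terms by expectations that depend neither on m nor on the elements of S.
  \<open>D S\<close> is a channel only for nonempty S, where some outcome can complete the
  measurement.\<close>

lemma position_based_code:
  fixes p :: "nat \<Rightarrow> real" and n K :: nat
  assumes N: "quantum_channel dA dB N"
    and p: "\<And>x. x < n \<Longrightarrow> 0 \<le> p x" "(\<Sum>x<n. p x) = 1"
    and \<rho>: "\<And>x. x < n \<Longrightarrow> density dA (\<rho> x)"
    and T: "\<And>x. x < n \<Longrightarrow> psd dB (T x)" and T1: "\<And>x. x < n \<Longrightarrow> psd dB (1\<^sub>m dB - T x)"
    and K: "0 < K"
  obtains e \<theta> E D where "density (e * e) \<theta>" "diagonal_mat \<theta>" "quantum_channel (K * e) dA E"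
    "\<And>S. S \<subseteq> {..<K} \<Longrightarrow> S \<noteq> {} \<Longrightarrow> quantum_channel (dB * e) K (D S)"
    "\<And>S X. diagonal_mat (D S X)"
    "\<And>S m. S \<subseteq> {..<K} \<Longrightarrow> m \<in> S \<Longrightarrow> error_prob dA dB N K e e \<theta> E (D S) m \<le>
      2 * (1 - (\<Sum>x<n. p x * Re (mtrace (T x * N (\<rho> x))))) +
      4 * ((real (card S) - 1) * (\<Sum>x<n. \<Sum>y<n. p x * p y * Re (mtrace (T y * N (\<rho> x)))))"
proof -
  obtain e :: nat and P c where P: "\<And>k. k < e \<Longrightarrow> 0 \<le> P k" "(\<Sum>k<e. P k) = (1 :: real)"
    and cn: "\<And>k m. k < e \<Longrightarrow> m < K \<Longrightarrow> c k m < n"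
    and one: "\<And>g m. m < K \<Longrightarrow> (\<Sum>k<e. P k * g (c k m)) = (\<Sum>x<n. p x * g x)"
    and two: "\<And>h m m'. m < K \<Longrightarrow> m' < K \<Longrightarrow> m \<noteq> m' \<Longrightarrow>
      (\<Sum>k<e. P k * h (c k m) (c k m')) = (\<Sum>x<n. \<Sum>y<n. p x * p y * h x y)"
    by (rule random_codebook[of n p K, OF p(1) p(2) K]) (assumption | rule that)+
  have e0: "0 < e" using P(2) by (cases e) auto
  have c\<rho>: "\<rho> x \<in> carrier_mat dA dA" if "x < n" for x
    using \<rho>[OF that] psdD(1) by (auto simp: density_def)
  have dN: "density dB (N (\<rho> x))" if "x < n" for x
    using channel_density[OF N \<rho>[OF that]] .
  have cN: "N (\<rho> x) \<in> carrier_mat dB dB" if "x < n" for x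
    using channel_carrier[OF N c\<rho>[OF that]] .
  \<comment> \<open>Perfectly correlated randomness: E_A and E_B both hold k, with probability
    \<open>P k\<close>.\<close>
  define \<theta> where "\<theta> = block_diag e e (\<lambda>k. complex_of_real (P k) \<cdot>\<^sub>m basis_state e k)"
  \<comment> \<open>The encoder's input index is m * e + k, so \<open>div\<close> recovers the
    message and \<open>mod\<close> the codebook.\<close>
  define R where "R i = \<rho> (c (i mod e) (i div e))" for i
  define E where "E = measure_prepare dA (K * e) (basis_state (K * e)) R"
  have R: "density dA (R i)" if "i < K * e" for i
    unfolding R_def using that e0 by (intro \<rho> cn) (auto simp: less_mult_imp_div_less)
  have Rk: "R (m * e + k) = \<rho> (c k m)" if "k < e" for m k
    unfolding R_def using that by simp
  have E: "quantum_channel (K * e) dA E"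
    unfolding E_def
  proof (rule measure_prepare_channel)
    fix a b assume "a < K * e" "b < K * e"
    then show "(\<Sum>i<K * e. basis_state (K * e) i $$ (a, b)) = 1\<^sub>m (K * e) $$ (a, b)"
      by (simp add: basis_state_def)
  qed (use R psd_basis_state in auto)
  have psdP: "psd e (complex_of_real (P k) \<cdot>\<^sub>m basis_state e k)" if "k < e" for k
  proof -
    have "complex_of_real (P k) \<cdot>\<^sub>m basis_state e k = mat_diag e (\<lambda>i. if i = k then complex_of_real (P k) else 0)"
      unfolding basis_state_eq_mat_diag by (intro eq_matI) (auto simp: mat_diag_def)
    then show ?thesis using P(1)[OF that] by (auto intro!: psd_mat_diag simp: less_eq_complex_def)
  qed
  have trP: "mtrace (a \<cdot>\<^sub>m A) = a * mtrace A" if "A \<in> carrier_mat d d" for a A d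
    using that unfolding mtrace_def by (simp add: sum_distrib_left)
  have "mtrace \<theta> = (\<Sum>k<e. complex_of_real (P k))"
    unfolding \<theta>_def using density_basis_state
    by (subst mtrace_block_diag) (auto simp: trP[of _ e] density_def)
  then have \<theta>: "density (e * e) \<theta>"
    unfolding density_def using psd_block_diag[OF psdP] P(2) by (simp add: \<theta>_def flip: of_real_sum)
  have "\<theta> $$ (i, j) = 0" if ij: "i < e * e" "j < e * e" "i \<noteq> j" for i j
  proof (cases "i mod e = j mod e")
    case True
    with \<open>i \<noteq> j\<close> have "i div e \<noteq> j div e" by (metis div_mult_mod_eq)
    then show ?thesis using ij True by (auto simp: \<theta>_def block_diag_def basis_state_def less_mult_imp_div_less)
  qed (use ij in \<open>auto simp: \<theta>_def block_diag_def\<close>)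
  then have \<theta>d: "diagonal_mat \<theta>"
    unfolding diagonal_mat_def by (auto simp: \<theta>_def block_diag_def)
  define good where "good S k L \<longleftrightarrow> (\<forall>i\<in>S. psd dB (L i)) \<and>
      (\<forall>a<dB. \<forall>b<dB. (\<Sum>i\<in>S. L i $$ (a, b)) = 1\<^sub>m dB $$ (a, b)) \<and>
      (\<forall>i\<in>S. \<forall>\<omega>. density dB \<omega> \<longrightarrow>
        1 - 2 * (1 - Re (mtrace (T (c k i) * \<omega>))) - 4 * (\<Sum>j\<in>S - {i}. Re (mtrace (T (c k j) * \<omega>)))
        \<le> Re (mtrace (L i * \<omega>)))" for S k L
  have ex_good: "\<exists>L. good S k L" if S: "S \<subseteq> {..<K}" "S \<noteq> {}" and k: "k < e" for S k
  proof -
    obtain i0 where i0: "i0 \<in> S" using S(2) by auto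
    have fin: "finite S" using S(1) finite_subset by blast
    have F: "psd dB (T (c k i))" "psd dB (1\<^sub>m dB - T (c k i))" if "i \<in> S" for i
      using T T1 cn[OF k] S(1) that by auto
    obtain L where L: "\<And>i. i \<in> S \<Longrightarrow> psd dB (L i)"
      "\<And>a b. a < dB \<Longrightarrow> b < dB \<Longrightarrow> (\<Sum>i\<in>S. L i $$ (a, b)) = 1\<^sub>m dB $$ (a, b)"
      "\<And>i \<omega>. i \<in> S \<Longrightarrow> density dB \<omega> \<Longrightarrow>
        1 - 2 * (1 - Re (mtrace (T (c k i) * \<omega>))) - 4 * (\<Sum>j\<in>S - {i}. Re (mtrace (T (c k j) * \<omega>)))
        \<le> Re (mtrace (L i * \<omega>))"
      by (rule pretty_good_measurement_trace[of S i0 dB "\<lambda>i. T (c k i)", OF fin i0 F]) (assumption | rule that)+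
    show ?thesis
      unfolding good_def by (intro exI[of _ L] conjI ballI allI impI) (rule L; assumption)+
  qed
  \<comment> \<open>One measurement is chosen for each S and k, independently of the message, so
    that the decoder is a function of S alone.\<close>
  define L where "L S k = (SOME L. good S k L)" for S k
  have good: "good S k (L S k)" if "S \<subseteq> {..<K}" "S \<noteq> {}" "k < e" for S k
    unfolding L_def by (rule someI_ex[OF ex_good[OF that]])
  have L: "psd dB (L S k i)" if "S \<subseteq> {..<K}" "S \<noteq> {}" "k < e" "i \<in> S" for S k i
    using good[OF that(1-3)] that(4) unfolding good_def by blast
  have L1: "(\<Sum>i\<in>S. L S k i $$ (a, b)) = 1\<^sub>m dB $$ (a, b)"
    if "S \<subseteq> {..<K}" "S \<noteq> {}" "k < e" "a < dB" "b < dB" for S k a b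
    using good[OF that(1-3)] that(4,5) unfolding good_def by blast
  have bound: "1 - 2 * (1 - Re (mtrace (T (c k i) * \<omega>))) - 4 * (\<Sum>j\<in>S - {i}. Re (mtrace (T (c k j) * \<omega>)))
        \<le> Re (mtrace (L S k i * \<omega>))"
    if "S \<subseteq> {..<K}" "S \<noteq> {}" "k < e" "i \<in> S" "density dB \<omega>" for S k i \<omega>
    using good[OF that(1-3)] that(4,5) unfolding good_def by blast
  \<comment> \<open>The decoder reads k from E_B and then applies the k-th measurement to B.
    Messages outside S get the zero effect, so the effects indexed by all of [0, K) still sum to the
    identity.\<close>
  define F where "F S i = block_diag dB e (\<lambda>k. if i \<in> S then L S k i else 0\<^sub>m dB dB)" for S i
  define D where "D S = measure_prepare K K (F S) (basis_state K)" for S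
  have D: "quantum_channel (dB * e) K (D S)" if S: "S \<subseteq> {..<K}" "S \<noteq> {}" for S
    unfolding D_def
  proof (rule measure_prepare_channel)
    show "psd (dB * e) (F S i)" for i
      unfolding F_def using L[OF S] psd_zero by (intro psd_block_diag) auto
    fix a b assume ab: "a < dB * e" "b < dB * e"
    have "(\<Sum>i<K. F S i $$ (a, b)) = (\<Sum>i\<in>S. F S i $$ (a, b))"
      using S ab by (intro sum.mono_neutral_right) (auto simp: F_def block_diag_def less_mult_imp_div_less)
    also have "\<dots> = (if a mod e = b mod e then \<Sum>i\<in>S. L S (a mod e) i $$ (a div e, b div e) else 0)"
      using ab by (auto simp: F_def block_diag_def)
    also have "\<dots> = (if a mod e = b mod e \<and> a div e = b div e then 1 else 0)"
      using L1[OF S, of "a mod e" "a div e" "b div e"] ab e0 by (auto simp: less_mult_imp_div_less)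
    also have "\<dots> = 1\<^sub>m (dB * e) $$ (a, b)"
      using ab by simp (metis div_mult_mod_eq)
    finally show "(\<Sum>i<K. F S i $$ (a, b)) = 1\<^sub>m (dB * e) $$ (a, b)" .
  qed (rule density_basis_state)
  have err: "error_prob dA dB N K e e \<theta> E (D S) m \<le>
      2 * (1 - (\<Sum>x<n. p x * Re (mtrace (T x * N (\<rho> x))))) +
      4 * ((real (card S) - 1) * (\<Sum>x<n. \<Sum>y<n. p x * p y * Re (mtrace (T y * N (\<rho> x)))))"
    if S: "S \<subseteq> {..<K}" and m: "m \<in> S" for S m
  proof -
    have S0: "S \<noteq> {}" and mK: "m < K" and fin: "finite S" using S m finite_subset by auto
    let ?t = "\<lambda>x y. Re (mtrace (T y * N (\<rho> x)))"
    let ?Z = "block_diag dB e (\<lambda>k. complex_of_real (P k) \<cdot>\<^sub>m N (\<rho> (c k m)))"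
    have cm: "c k m < n" if "k < e" for k using cn[OF that mK] .
    have Eb: "E (complex_of_real (P k) \<cdot>\<^sub>m basis_state (K * e) (m * e + k)) = complex_of_real (P k) \<cdot>\<^sub>m \<rho> (c k m)"
      if k: "k < e" for k
    proof -
      have "E (basis_state (K * e) (m * e + k)) = R (m * e + k)"
        unfolding E_def
        by (rule measure_prepare_basis_state[OF pair_index_less[OF mK k]])
          (use R psdD(1) in \<open>auto simp: density_def\<close>)
      then show ?thesis using channel_smult[OF E basis_state_carrier] Rk[OF k] by simp
    qed
    have "tensor (basis_state K m) \<theta> =
        block_diag (K * e) e (\<lambda>k. tensor (basis_state K m) (complex_of_real (P k) \<cdot>\<^sub>m basis_state e k))"
      unfolding \<theta>_def by (rule tensor_block_diag) auto
    also have "\<dots> = block_diag (K * e) e (\<lambda>k. complex_of_real (P k) \<cdot>\<^sub>m basis_state (K * e) (m * e + k))"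
      using tensor_basis_state[OF mK] by (intro eq_mat_pairs[of _ "K * e" e]) (auto simp: block_diag_index)
    finally have "on_first (K * e) dA e E (tensor (basis_state K m) \<theta>) =
        block_diag dA e (\<lambda>k. E (complex_of_real (P k) \<cdot>\<^sub>m basis_state (K * e) (m * e + k)))"
      using on_first_block_diag[OF E] by simp
    also have "\<dots> = block_diag dA e (\<lambda>k. complex_of_real (P k) \<cdot>\<^sub>m \<rho> (c k m))"
      using Eb by (intro eq_mat_pairs[of _ dA e]) (auto simp: block_diag_index)
    finally have "on_first dA dB e N (on_first (K * e) dA e E (tensor (basis_state K m) \<theta>)) =
        block_diag dB e (\<lambda>k. N (complex_of_real (P k) \<cdot>\<^sub>m \<rho> (c k m)))"
      using on_first_block_diag[OF N] c\<rho>[OF cm] by simp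
    also have "\<dots> = ?Z"
      using channel_smult[OF N c\<rho>[OF cm]] by (intro eq_mat_pairs[of _ dB e]) (auto simp: block_diag_index)
    finally have out: "code_output dA dB N K e e \<theta> E (D S) m = D S ?Z"
      unfolding code_output_def by simp
    have cZ: "?Z \<in> carrier_mat (dB * e) (dB * e)" by simp
    \<comment> \<open>\<open>?Z\<close> is the joint state of B and E_B before decoding. Since the
      channel preserves its unit trace, the outcome probabilities sum to 1 and the error is one
      minus the diagonal entry at \<open>m\<close>.\<close>
    have "mtrace (D S ?Z) = mtrace ?Z" using channel_mtrace[OF D[OF S S0] cZ] .
    also have "\<dots> = (\<Sum>k<e. complex_of_real (P k))"
      using cN[OF cm] dN[OF cm] by (subst mtrace_block_diag) (auto simp: trP[of _ dB] density_def)
    finally have "(\<Sum>i<K. D S ?Z $$ (i, i)) = 1"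
      using P(2) channel_carrier[OF D[OF S S0] cZ] by (simp add: mtrace_def flip: of_real_sum)
    then have "Re (\<Sum>i<K. D S ?Z $$ (i, i)) = 1" by simp
    then have "error_prob dA dB N K e e \<theta> E (D S) m = 1 - Re (D S ?Z $$ (m, m))"
      unfolding error_prob_def out using mK by (simp add: sum_diff1)
    moreover have "D S ?Z $$ (m, m) = (\<Sum>k<e. complex_of_real (P k) * mtrace (L S k m * N (\<rho> (c k m))))"
    proof -
      have "D S ?Z $$ (m, m) = mtrace (F S m * ?Z)"
        unfolding D_def by (rule measure_prepare_diag_entry[OF mK])
      also have "\<dots> = (\<Sum>k<e. mtrace (block dB e (F S m) k k * (complex_of_real (P k) \<cdot>\<^sub>m N (\<rho> (c k m)))))"
        using cN[OF cm] by (subst mtrace_mult_block_diag) (auto simp: F_def)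
      also have "\<dots> = (\<Sum>k<e. complex_of_real (P k) * mtrace (L S k m * N (\<rho> (c k m))))"
      proof (intro sum.cong refl)
        fix k assume "k \<in> {..<e}"
        then have k: "k < e" by simp
        note cL = psdD(1)[OF L[OF S S0 k m]]
        show "mtrace (block dB e (F S m) k k * (complex_of_real (P k) \<cdot>\<^sub>m N (\<rho> (c k m)))) =
            complex_of_real (P k) * mtrace (L S k m * N (\<rho> (c k m)))"
          using k m cL cN[OF cm[OF k]] by (simp add: F_def block_block_diag mtrace_mult_smult[of _ dB])
      qed
      finally show ?thesis .
    qed
    moreover have "1 - 2 * (1 - (\<Sum>x<n. p x * ?t x x)) - 4 * ((real (card S) - 1) * (\<Sum>x<n. \<Sum>y<n. p x * p y * ?t x y))
        \<le> (\<Sum>k<e. P k * Re (mtrace (L S k m * N (\<rho> (c k m)))))"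
    proof -
      \<comment> \<open>The bound for fixed k is averaged with weights \<open>P k\<close>. The term
        of \<open>m\<close> itself becomes the acceptance probability by \<open>one\<close>; each of
        the card S - 1 competitors becomes a false alarm by \<open>two\<close>, its codeword being
        independent of that of \<open>m\<close>.\<close>
      have "(\<Sum>k<e. P k * (1 - 2 * (1 - ?t (c k m) (c k m)) - 4 * (\<Sum>j\<in>S - {m}. ?t (c k m) (c k j))))
          \<le> (\<Sum>k<e. P k * Re (mtrace (L S k m * N (\<rho> (c k m)))))"
        using P(1) bound[OF S S0 _ m dN[OF cm]] by (intro sum_mono mult_left_mono) auto
      also have "(\<Sum>k<e. P k * (1 - 2 * (1 - ?t (c k m) (c k m)) - 4 * (\<Sum>j\<in>S - {m}. ?t (c k m) (c k j)))) =
          - (\<Sum>k<e. P k) + 2 * (\<Sum>k<e. P k * ?t (c k m) (c k m)) -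
          4 * (\<Sum>k<e. \<Sum>j\<in>S - {m}. P k * ?t (c k m) (c k j))"
        unfolding sum_distrib_left sum_negf[symmetric] sum.distrib[symmetric] sum_subtractf[symmetric]
        by (intro sum.cong refl) (simp add: algebra_simps sum_distrib_left)
      also have "(\<Sum>k<e. \<Sum>j\<in>S - {m}. P k * ?t (c k m) (c k j)) =
          (\<Sum>j\<in>S - {m}. \<Sum>x<n. \<Sum>y<n. p x * p y * ?t x y)"
        using S mK by (subst sum.swap, intro sum.cong refl two) auto
      also have "(\<Sum>k<e. P k * ?t (c k m) (c k m)) = (\<Sum>x<n. p x * ?t x x)"
        by (rule one[OF mK])
      finally show ?thesis
        using P(2) fin m by (simp add: of_nat_diff card_gt_0_iff Suc_le_eq S0)
    qed
    ultimately show ?thesis by simp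
  qed
  have Dd: "diagonal_mat (D S X)" for S X
    unfolding D_def by (rule diagonal_measure_prepare)
  show thesis
    by (rule that[OF \<theta> \<theta>d E D Dd err])
qed

section \<open>Choice of the test and error budget\<close>

theorem theorem10:
  fixes N :: "complex mat \<Rightarrow> complex mat" and dA dB :: nat and \<epsilon> \<delta> \<alpha> R :: real
  assumes "quantum_channel dA dB N"
    and "0 < \<epsilon>" "\<epsilon> < 1" "0 < \<delta>" "\<delta> < 1"
    and "0 < \<alpha>"
    and "0 \<le> R"
    and "ereal R \<le> ereal (1 / \<alpha>) * cq_hyp_test_info dA dB N \<epsilon> - ereal (4 / \<alpha> * log 2 (2 / \<delta>))"
  shows "\<exists>eA eB \<theta> E D. randomness_assisted_code dA dB N R (2 * \<epsilon> + 2 * \<delta>) \<alpha> eA eB \<theta> E D"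
proof -
  let ?I = "cq_hyp_test_info dA dB N \<epsilon>"
  define K where "K = nat \<lfloor>2 powr R\<rfloor>"
  define L where "L = nat \<lfloor>2 powr (\<alpha> * R)\<rfloor>"
  have K0: "0 < K"
    unfolding K_def using \<open>0 \<le> R\<close> ge_one_powr_ge_zero[of 2 R] by simp
  \<comment> \<open>With R \<ge> 0 the rounded size is at least 1: admissible subsets are nonempty,
    and \<open>real L - 1\<close>, the number of competitors, is nonnegative.\<close>
  have L0: "0 < L"
    unfolding L_def using \<open>0 \<le> R\<close> \<open>0 < \<alpha>\<close> ge_one_powr_ge_zero[of 2 "\<alpha> * R"] by simp
  have LR: "real L \<le> 2 powr (\<alpha> * R)"
    unfolding L_def by simp
  \<comment> \<open>The rate condition, multiplied by \<alpha>, only bounds \<alpha> R + 4 log (2 /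
    \<delta>) by the information from above. One bit is given up to lie strictly below the supremum,
    at the price of a factor 2 in the false alarm probability.\<close>
  define c where "c = \<alpha> * R + 4 * log 2 (2 / \<delta>) - 1"
  have info: "ereal c < ?I"
  proof (cases ?I)
    case (real r)
    then have "R \<le> 1 / \<alpha> * r - 4 / \<alpha> * log 2 (2 / \<delta>)"
      using assms(8) by simp
    then have "\<alpha> * R \<le> \<alpha> * (1 / \<alpha> * r - 4 / \<alpha> * log 2 (2 / \<delta>))"
      using \<open>0 < \<alpha>\<close> by simp
    also have "\<dots> = r - 4 * log 2 (2 / \<delta>)"
      using \<open>0 < \<alpha>\<close> by (simp add: field_simps)
    finally show ?thesis
      unfolding c_def real by simp
  next
    \<comment> \<open>Information equal to minus infinity would make the right-hand side of the rate
      condition minus infinity, below the real number R.\<close>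
    case MInf
    then show ?thesis using assms(8) \<open>0 < \<alpha>\<close> by simp
  qed simp
  obtain n :: nat and p \<rho> T where p: "\<And>x. x < n \<Longrightarrow> 0 \<le> p x" "(\<Sum>x<n. p x) = 1"
    and \<rho>: "\<And>x. x < n \<Longrightarrow> density dA (\<rho> x)"
    and T: "\<And>x. x < n \<Longrightarrow> psd dB (T x)" "\<And>x. x < n \<Longrightarrow> psd dB (1\<^sub>m dB - T x)"
    and acc: "1 - \<epsilon> \<le> (\<Sum>x<n. p x * Re (mtrace (T x * N (\<rho> x))))"
    and fa: "(\<Sum>x<n. \<Sum>y<n. p x * p y * Re (mtrace (T y * N (\<rho> x)))) < 2 powr (- c)" (is "?\<tau> < _")
    by (rule cq_tests[OF assms(1) info]) (assumption | rule that)+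
  obtain e \<theta> E D where code: "density (e * e) \<theta>" "diagonal_mat \<theta>" "quantum_channel (K * e) dA E"
    "\<And>S. S \<subseteq> {..<K} \<Longrightarrow> S \<noteq> {} \<Longrightarrow> quantum_channel (dB * e) K (D S)"
    "\<And>S X. diagonal_mat (D S X)"
    and err: "\<And>S m. S \<subseteq> {..<K} \<Longrightarrow> m \<in> S \<Longrightarrow> error_prob dA dB N K e e \<theta> E (D S) m \<le>
      2 * (1 - (\<Sum>x<n. p x * Re (mtrace (T x * N (\<rho> x))))) + 4 * ((real (card S) - 1) * ?\<tau>)"
    by (rule position_based_code[OF assms(1) p(1) p(2) \<rho> T K0]) (assumption | rule that)+
  have false_alarm: "4 * ((real L - 1) * ?\<tau>) \<le> 2 * \<delta>"
  proof -
    \<comment> \<open>The budget: 2^(-c) = 2 (\<delta> / 2)^4 2^(-\<alpha> R) = \<delta>^4 / (8 *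
      2^(\<alpha> R)). Fewer than 2^(\<alpha> R) competitors, each weighted by 4, cost at most
      \<delta>^4 / 2, which is at most \<delta> / 2 and so within 2 \<delta>.\<close>
    have "2 powr (4 * log 2 (2 / \<delta>)) = (2 / \<delta>) ^ 4"
      using \<open>0 < \<delta>\<close> by (simp add: powr_powr[symmetric] mult.commute[of 4] flip: powr_numeral)
    then have "2 powr c = 2 powr (\<alpha> * R) * (2 / \<delta>) ^ 4 / 2"
      unfolding c_def by (simp add: powr_add powr_diff)
    then have pc: "2 powr (- c) = \<delta> ^ 4 / (8 * 2 powr (\<alpha> * R))"
      using \<open>0 < \<delta>\<close> by (simp add: powr_minus_divide field_simps)
    have "(real L - 1) * ?\<tau> \<le> (real L - 1) * 2 powr (- c)"
      using fa L0 by (intro mult_left_mono) auto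
    also have "\<dots> \<le> 2 powr (\<alpha> * R) * 2 powr (- c)"
      using LR by (intro mult_right_mono) auto
    also have "\<dots> = \<delta> ^ 4 / 8"
      unfolding pc by simp
    finally have "4 * ((real L - 1) * ?\<tau>) \<le> \<delta> ^ 4 / 2" by simp
    also have "\<delta> ^ 4 \<le> \<delta> ^ 1"
      using \<open>0 < \<delta>\<close> \<open>\<delta> < 1\<close> by (intro power_decreasing) auto
    finally show ?thesis using \<open>0 < \<delta>\<close> by simp
  qed
  have "randomness_assisted_code dA dB N R (2 * \<epsilon> + 2 * \<delta>) \<alpha> e e \<theta> E D"
    unfolding randomness_assisted_code_def Let_def K_def[symmetric] L_def[symmetric]
  proof (intro conjI allI impI ballI)
    fix S assume S: "S \<subseteq> {..<K} \<and> card S = L"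
    then have "S \<noteq> {}" using L0 by auto
    then show "quantum_channel (dB * e) K (D S)" using code(4) S by blast
    fix m assume "m \<in> S"
    then have "error_prob dA dB N K e e \<theta> E (D S) m \<le>
        2 * (1 - (\<Sum>x<n. p x * Re (mtrace (T x * N (\<rho> x))))) + 4 * ((real L - 1) * ?\<tau>)"
      using err[of S m] S by simp
    then show "error_prob dA dB N K e e \<theta> E (D S) m \<le> 2 * \<epsilon> + 2 * \<delta>"
      using acc false_alarm by simp
  qed (rule code)+
  then show ?thesis by blast
qed

end
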